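(* Let $G$ be a group, let $\mathcal{L}$ be an irreducible $G$-module, and let $V, V'$ be irreducible $G$-invariant affine cones (each lying in some $G$-module) of dimensions $N \geq 1$ and $N' \geq 1$, respectively. Let $T\colon \mathbb{P}(V) \to \mathrm{Gr}(N, \mathcal{L})$, $[x] \mapsto T_x$, and $U\colon \mathbb{P}(V') \to \mathrm{Gr}(N', \mathcal{L})$, $[y] \mapsto U_y$, be $G$-equivariant algebraic maps. Then there exists an interval $\mathcal{I} \subseteq \mathbb{N}$ of length at most $N'$ such that for all $m \in \mathbb{N} \setminus \mathcal{I}$, and generic $x_1,\ldots,x_m \in V$, generic $y \in V'$, one of the following holds true: (1) $\langle T_{x_1}, \ldots, T_{x_m} \rangle \cap U_y = \{0\}$, or (2) $\langle T_{x_1}, \ldots, T_{x_m} \rangle = \mathcal{L}$.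
   Context: Everything is over $\mathbb{C}$ and $G$-modules are finite-dimensional vector spaces with a linear $G$-action; a $G$-module is irreducible if it is nonzero and has no proper nonzero $G$-submodule. An affine cone is a Zariski closed subset $V$ of a vector space with $\mathbb{C}\cdot V \subseteq V$; $\mathbb{P}(V)$ is the corresponding projective variety. $V$ is $G$-invariant if $gv \in V$ for all $g \in G$, $v \in V$. $\mathrm{Gr}(N, \mathcal{L})$ denotes the Grassmannian of $N$-dimensional linear subspaces of $\mathcal{L}$, with its canonical $G$-action. $\langle T_{x_1}, \ldots, T_{x_m}\rangle$ denotes the linear span (sum) of the subspaces $T_{x_i}$. An interval in $\mathbb{N}$ is a set of consecutive integers $\{a+1,\ldots,b\}$ and its length is its cardinality $b-a$. "Generic" means: for all tuples in some nonempty Zariski open subset of $V^m \times V'$. *)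

theory Defs
  imports
    Complex_Main
    "HOL-Library.FuncSet"
    "HOL-Library.Extended_Nat"
    "HOL-Algebra.Group_Action"
    "HOL-Analysis.Abstract_Topology"
begin

text \<open>
  A complex vector space is an additive group \<open>'a\<close> with a scalar multiplication
  \<open>s :: complex \<Rightarrow> 'a \<Rightarrow> 'a\<close>; the notions of span, subspace and dimension are those of the locales
  \<^locale>\<open>module\<close> and \<^locale>\<open>vector_space\<close>, which take \<open>s\<close> as a parameter.
\<close>

section \<open>Group representations\<close>

definition G_module :: "('g, 'b) monoid_scheme \<Rightarrow> (complex \<Rightarrow> 'a::ab_group_add \<Rightarrow> 'a) \<Rightarrow> ('g \<Rightarrow> 'a \<Rightarrow> 'a) \<Rightarrow> bool"
  where "G_module G s \<rho> \<longleftrightarrow>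
    (\<exists>B. finite_dimensional_vector_space s B) \<and>
    group_action G UNIV \<rho> \<and>
    (\<forall>g\<in>carrier G. Vector_Spaces.linear s s (\<rho> g))"

definition G_invariant :: "('g, 'b) monoid_scheme \<Rightarrow> ('g \<Rightarrow> 'a \<Rightarrow> 'a) \<Rightarrow> 'a set \<Rightarrow> bool"
  where "G_invariant G \<rho> V \<longleftrightarrow> (\<forall>g\<in>carrier G. \<forall>v\<in>V. \<rho> g v \<in> V)"

definition irreducible_G_module ::
    "('g, 'b) monoid_scheme \<Rightarrow> (complex \<Rightarrow> 'a::ab_group_add \<Rightarrow> 'a) \<Rightarrow> ('g \<Rightarrow> 'a \<Rightarrow> 'a) \<Rightarrow> bool"
  where "irreducible_G_module G s \<rho> \<longleftrightarrow>
    G_module G s \<rho> \<and> (UNIV :: 'a set) \<noteq> {0} \<and>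
    (\<forall>W. module.subspace s W \<and> G_invariant G \<rho> W \<longrightarrow> W = {0} \<or> W = UNIV)"

section \<open>Polynomial functions and the Zariski topology\<close>

text \<open>
  The algebra of polynomial functions generated by a set \<open>C\<close> of coordinate functions. On a
  finite-dimensional vector space, \<open>C\<close> is the set of all linear functionals.
\<close>

inductive_set poly_funs :: "('a \<Rightarrow> complex) set \<Rightarrow> ('a \<Rightarrow> complex) set"
  for C :: "('a \<Rightarrow> complex) set" where
  const: "(\<lambda>_. c) \<in> poly_funs C"
| coord: "f \<in> C \<Longrightarrow> f \<in> poly_funs C"
| add: "p \<in> poly_funs C \<Longrightarrow> q \<in> poly_funs C \<Longrightarrow> (\<lambda>x. p x + q x) \<in> poly_funs C"
| mult: "p \<in> poly_funs C \<Longrightarrow> q \<in> poly_funs C \<Longrightarrow> (\<lambda>x. p x * q x) \<in> poly_funs C"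

definition zero_locus :: "('a \<Rightarrow> complex) set \<Rightarrow> 'a set"
  where "zero_locus P = {x. \<forall>p\<in>P. p x = 0}"

definition zariski :: "('a \<Rightarrow> complex) set \<Rightarrow> 'a topology"
  where "zariski C = topology (\<lambda>S. \<exists>P\<subseteq>poly_funs C. S = - zero_locus P)"

definition linear_functionals :: "(complex \<Rightarrow> 'a::ab_group_add \<Rightarrow> 'a) \<Rightarrow> ('a \<Rightarrow> complex) set"
  where "linear_functionals s = {f. Vector_Spaces.linear s (*) f}"

text \<open>
  Coordinates on \<open>W\<^sup>m \<times> W'\<close>, where an \<open>m\<close>-tuple of vectors is a function on \<open>{..<m}\<close>. Note that
  the resulting topology is the Zariski topology of the product, not the product topology.
\<close>

definition tuple_coords ::
    "nat \<Rightarrow> (complex \<Rightarrow> 'a::ab_group_add \<Rightarrow> 'a) \<Rightarrow> (complex \<Rightarrow> 'c::ab_group_add \<Rightarrow> 'c) \<Rightarrow>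
      ((nat \<Rightarrow> 'a) \<times> 'c \<Rightarrow> complex) set"
  where "tuple_coords m s s' =
    {\<lambda>(x, y). f (x i) | i f. i < m \<and> f \<in> linear_functionals s} \<union>
    {\<lambda>(x, y). f y | f. f \<in> linear_functionals s'}"

definition irreducible_space :: "'a topology \<Rightarrow> bool"
  where "irreducible_space X \<longleftrightarrow>
    topspace X \<noteq> {} \<and>
    (\<forall>A B. closedin X A \<and> closedin X B \<and> A \<union> B = topspace X \<longrightarrow> A = topspace X \<or> B = topspace X)"

definition krull_dim :: "'a topology \<Rightarrow> enat"
  where "krull_dim X = Sup {enat n | n. \<exists>Z :: nat \<Rightarrow> 'a set.
    (\<forall>i\<le>n. closedin X (Z i) \<and> irreducible_space (subtopology X (Z i))) \<and>
    (\<forall>i<n. Z i \<subset> Z (Suc i))}"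

definition generically :: "'a topology \<Rightarrow> ('a \<Rightarrow> bool) \<Rightarrow> bool"
  where "generically X P \<longleftrightarrow> (\<exists>S. openin X S \<and> S \<noteq> {} \<and> (\<forall>x\<in>S. P x))"

abbreviation zariski_on :: "(complex \<Rightarrow> 'a::ab_group_add \<Rightarrow> 'a) \<Rightarrow> 'a set \<Rightarrow> 'a topology"
  where "zariski_on s V \<equiv> subtopology (zariski (linear_functionals s)) V"

section \<open>Affine cones and their projectivizations\<close>

definition affine_cone :: "(complex \<Rightarrow> 'a::ab_group_add \<Rightarrow> 'a) \<Rightarrow> 'a set \<Rightarrow> bool"
  where "affine_cone s V \<longleftrightarrow>
    closedin (zariski (linear_functionals s)) V \<and> (\<forall>c. \<forall>v\<in>V. s c v \<in> V)"

text \<open>The point \<open>[x]\<close> of projective space is the line \<open>module.span s {x}\<close>.\<close>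

definition projectivization :: "(complex \<Rightarrow> 'a::ab_group_add \<Rightarrow> 'a) \<Rightarrow> 'a set \<Rightarrow> 'a set set"
  where "projectivization s V = {module.span s {x} | x. x \<in> V \<and> x \<noteq> 0}"

definition homogeneous_polys :: "(complex \<Rightarrow> 'a::ab_group_add \<Rightarrow> 'a) \<Rightarrow> nat \<Rightarrow> ('a \<Rightarrow> complex) set"
  where "homogeneous_polys s d =
    {p \<in> poly_funs (linear_functionals s). \<forall>c x. p (s c x) = c ^ d * p x}"

definition proj_zero_locus ::
    "(complex \<Rightarrow> 'a::ab_group_add \<Rightarrow> 'a) \<Rightarrow> ('a \<Rightarrow> complex) set \<Rightarrow> 'a set set"
  where "proj_zero_locus s P = {l \<in> projectivization s UNIV. \<forall>p\<in>P. \<forall>x\<in>l. p x = 0}"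

definition proj_zariski :: "(complex \<Rightarrow> 'a::ab_group_add \<Rightarrow> 'a) \<Rightarrow> 'a set topology"
  where "proj_zariski s = topology (\<lambda>S. \<exists>P \<subseteq> (\<Union>d. homogeneous_polys s d).
    S = projectivization s UNIV - proj_zero_locus s P)"

abbreviation proj_zariski_on :: "(complex \<Rightarrow> 'a::ab_group_add \<Rightarrow> 'a) \<Rightarrow> 'a set \<Rightarrow> 'a set topology"
  where "proj_zariski_on s V \<equiv> subtopology (proj_zariski s) (projectivization s V)"

text \<open>
  Regular functions on a subset \<open>D\<close> (open, in all uses) of the projective variety of \<open>V\<close>: locally
  quotients of homogeneous polynomials of the same degree.
\<close>

definition regular_on ::
    "(complex \<Rightarrow> 'a::ab_group_add \<Rightarrow> 'a) \<Rightarrow> 'a set \<Rightarrow> 'a set set \<Rightarrow> ('a set \<Rightarrow> complex) \<Rightarrow> bool"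
  where "regular_on s V D f \<longleftrightarrow>
    (\<forall>l\<in>D. \<exists>S. openin (proj_zariski_on s V) S \<and> l \<in> S \<and> S \<subseteq> D \<and>
      (\<exists>d. \<exists>p\<in>homogeneous_polys s d. \<exists>q\<in>homogeneous_polys s d.
        \<forall>l'\<in>S. \<forall>x\<in>l' - {0}. q x \<noteq> 0 \<and> f l' = p x / q x))"

section \<open>Grassmannians\<close>

definition Gr :: "(complex \<Rightarrow> 'a::ab_group_add \<Rightarrow> 'a) \<Rightarrow> nat \<Rightarrow> 'a set set"
  where "Gr s k = {W. module.subspace s W \<and> vector_space.dim s W = k}"

text \<open>
  Let \<open>E\<close> be a subspace of dimension \<open>dim L - k\<close>. The standard affine chart of \<open>Gr(k, L)\<close> attached
  to \<open>E\<close> is the set of all \<open>W\<close> with \<open>W \<inter> E = {0}\<close>, that is, \<open>L = W \<oplus> E\<close>. Relative to a fixed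
  complement \<open>W0\<close> of \<open>E\<close> it is identified with the vector space \<open>Hom(W0, E)\<close>, by writing \<open>W\<close> as
  the graph \<open>{w + \<phi> w | w \<in> W0}\<close> of a linear map \<open>\<phi>\<close>; here \<open>w + \<phi> w\<close> is the projection of \<open>w\<close> to
  \<open>W\<close> along \<open>E\<close>. Projections of elements of \<open>E\<close> vanish, so the affine coordinates
  of \<open>W\<close> on the chart are the coordinates of the projections to \<open>W\<close> along \<open>E\<close> of all vectors of \<open>L\<close>.
  (For \<open>W\<close> outside of the chart, the value of the projection is irrelevant.)
\<close>

definition Gr_chart :: "(complex \<Rightarrow> 'a::ab_group_add \<Rightarrow> 'a) \<Rightarrow> nat \<Rightarrow> 'a set \<Rightarrow> 'a set set"
  where "Gr_chart s k E = {W \<in> Gr s k. W \<inter> E = {0}}"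

definition proj_along :: "'a::ab_group_add set \<Rightarrow> 'a set \<Rightarrow> 'a \<Rightarrow> 'a"
  where "proj_along W E v = (THE w. w \<in> W \<and> v - w \<in> E)"

text \<open>
  Algebraic maps from the projective variety of \<open>V\<close> to \<open>Gr(k, L)\<close>: the preimage of each standard
  chart is open, and the coordinates on the chart pull back to regular functions.
\<close>

definition algebraic_map_to_Gr ::
    "(complex \<Rightarrow> 'a::ab_group_add \<Rightarrow> 'a) \<Rightarrow> 'a set \<Rightarrow> (complex \<Rightarrow> 'l::ab_group_add \<Rightarrow> 'l) \<Rightarrow> nat \<Rightarrow>
      ('a set \<Rightarrow> 'l set) \<Rightarrow> bool"
  where "algebraic_map_to_Gr s V sL k T \<longleftrightarrow>
    T \<in> projectivization s V \<rightarrow> Gr sL k \<and>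
    (\<forall>E. module.subspace sL E \<and> vector_space.dim sL E + k = vector_space.dim sL UNIV \<longrightarrow>
      (let D = {l \<in> projectivization s V. T l \<in> Gr_chart sL k E} in
        openin (proj_zariski_on s V) D \<and>
        (\<forall>v. \<forall>f\<in>linear_functionals sL. regular_on s V D (\<lambda>l. f (proj_along (T l) E v)))))"

definition G_equivariant ::
    "('g, 'b) monoid_scheme \<Rightarrow> ('g \<Rightarrow> 'a \<Rightarrow> 'a) \<Rightarrow> ('g \<Rightarrow> 'l \<Rightarrow> 'l) \<Rightarrow> 'a set set \<Rightarrow>
      ('a set \<Rightarrow> 'l set) \<Rightarrow> bool"
  where "G_equivariant G \<rho> \<rho>L X T \<longleftrightarrow>
    (\<forall>g\<in>carrier G. \<forall>l\<in>X. T (\<rho> g ` l) = \<rho>L g ` T l)"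

section \<open>The two Zariski topologies are topologies\<close>

lemma openin_zariski:
  "openin (zariski C) S \<longleftrightarrow> (\<exists>P\<subseteq>poly_funs C. S = - zero_locus P)"
proof -
  have "istopology (\<lambda>S. \<exists>P\<subseteq>poly_funs C. S = - zero_locus P)"
    unfolding istopology_def
  proof (intro conjI allI impI)
    fix S S' assume "\<exists>P\<subseteq>poly_funs C. S = - zero_locus P" "\<exists>P\<subseteq>poly_funs C. S' = - zero_locus P"
    then obtain P P' where *: "P \<subseteq> poly_funs C" "S = - zero_locus P"
      "P' \<subseteq> poly_funs C" "S' = - zero_locus P'" by blast
    define R where "R = {\<lambda>x. p x * q x | p q. p \<in> P \<and> q \<in> P'}"
    have R: "(\<exists>r\<in>R. r x \<noteq> 0) \<longleftrightarrow> (\<exists>p\<in>P. p x \<noteq> 0) \<and> (\<exists>q\<in>P'. q x \<noteq> 0)" for x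
      unfolding R_def by fastforce
    have "R \<subseteq> poly_funs C"
    proof
      fix r assume "r \<in> R"
      then obtain p q where "r = (\<lambda>x. p x * q x)" "p \<in> P" "q \<in> P'" unfolding R_def by blast
      then show "r \<in> poly_funs C" using *(1,3) poly_funs.mult[of p C q] by (simp add: subset_iff)
    qed
    moreover
    have "x \<in> S \<inter> S' \<longleftrightarrow> x \<in> - zero_locus R" for x
      using R[of x] by (simp add: *(2,4) zero_locus_def)
    then have "S \<inter> S' = - zero_locus R" by blast
    ultimately show "\<exists>P\<subseteq>poly_funs C. S \<inter> S' = - zero_locus P" by blast
  next
    fix K :: "'a set set" assume "\<forall>S\<in>K. \<exists>P\<subseteq>poly_funs C. S = - zero_locus P"
    then obtain Q where *: "\<And>S. S \<in> K \<Longrightarrow> Q S \<subseteq> poly_funs C \<and> S = - zero_locus (Q S)" by metis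
    have "\<Union>K = (\<Union>S\<in>K. - zero_locus (Q S))" using * by auto
    also have "\<dots> = - zero_locus (\<Union>S\<in>K. Q S)" by (auto simp: zero_locus_def)
    finally show "\<exists>P\<subseteq>poly_funs C. \<Union>K = - zero_locus P" using * by (metis UN_least)
  qed
  then show ?thesis unfolding zariski_def by simp
qed

lemma openin_proj_zariski:
  assumes "vector_space s"
  shows "openin (proj_zariski s) S \<longleftrightarrow>
    (\<exists>P \<subseteq> (\<Union>d. homogeneous_polys s d). S = projectivization s UNIV - proj_zero_locus s P)"
proof -
  let ?H = "\<Union>d. homogeneous_polys s d" and ?X = "projectivization s UNIV"
  let ?Z = "proj_zero_locus s"
  have mult: "(\<lambda>x. p x * q x) \<in> ?H" if H: "p \<in> ?H" "q \<in> ?H" for p q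
  proof -
    obtain d e where "p \<in> homogeneous_polys s d" "q \<in> homogeneous_polys s e" using H by blast
    then have "(\<lambda>x. p x * q x) \<in> homogeneous_polys s (d + e)"
      using poly_funs.mult[of p "linear_functionals s" q] by (simp add: homogeneous_polys_def power_add)
    then show ?thesis by blast
  qed
  interpret vector_space s by fact
  have line: "(\<forall>z\<in>span {x}. p z = 0) \<longleftrightarrow> p x = 0" if "p \<in> ?H" for p x
    using that by (auto simp: homogeneous_polys_def span_singleton intro: span_base)
  have "istopology (\<lambda>S. \<exists>P\<subseteq>?H. S = ?X - ?Z P)"
    unfolding istopology_def
  proof (intro conjI allI impI)
    fix S S' assume "\<exists>P\<subseteq>?H. S = ?X - ?Z P" "\<exists>P\<subseteq>?H. S' = ?X - ?Z P"
    then obtain P P' where *: "P \<subseteq> ?H" "S = ?X - ?Z P" "P' \<subseteq> ?H" "S' = ?X - ?Z P'" by blast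
    define R where "R = {\<lambda>x. p x * q x | p q. p \<in> P \<and> q \<in> P'}"
    have R: "(\<exists>r\<in>R. r x \<noteq> 0) \<longleftrightarrow> (\<exists>p\<in>P. p x \<noteq> 0) \<and> (\<exists>q\<in>P'. q x \<noteq> 0)" for x
      unfolding R_def by fastforce
    have sub: "R \<subseteq> ?H" using * mult unfolding R_def by blast
    have mem: "span {x} \<in> ?Z Q \<longleftrightarrow> (\<forall>p\<in>Q. p x = 0)" if "Q \<subseteq> ?H" "x \<noteq> 0" for Q x
    proof -
      have "span {x} \<in> ?X" using that(2) unfolding projectivization_def by blast
      then have "span {x} \<in> ?Z Q \<longleftrightarrow> (\<forall>p\<in>Q. \<forall>z\<in>span {x}. p z = 0)"
        unfolding proj_zero_locus_def by simp
      also have "\<dots> \<longleftrightarrow> (\<forall>p\<in>Q. p x = 0)"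
        using line that(1) by (intro ball_cong refl) (blast dest: subsetD)
      finally show ?thesis .
    qed
    have "l \<in> S \<inter> S' \<longleftrightarrow> l \<in> ?X - ?Z R" if l: "l \<in> ?X" for l
    proof -
      obtain x where x: "l = span {x}" "x \<noteq> 0" using l by (auto simp: projectivization_def)
      have "l \<in> S \<inter> S' \<longleftrightarrow> (\<exists>p\<in>P. p x \<noteq> 0) \<and> (\<exists>q\<in>P'. q x \<noteq> 0)"
        using l mem[OF *(1) x(2)] mem[OF *(3) x(2)] unfolding *(2,4) x(1) by blast
      also have "\<dots> \<longleftrightarrow> (\<exists>r\<in>R. r x \<noteq> 0)" using R by simp
      also have "\<dots> \<longleftrightarrow> l \<in> ?X - ?Z R" using l mem[OF sub x(2)] unfolding x(1) by blast
      finally show ?thesis .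
    qed
    then have "S \<inter> S' = ?X - ?Z R" using *(2,4) by blast
    then show "\<exists>P\<subseteq>?H. S \<inter> S' = ?X - ?Z P" using sub by blast
  next
    fix K :: "'a set set set" assume "\<forall>S\<in>K. \<exists>P\<subseteq>?H. S = ?X - ?Z P"
    then obtain Q where *: "\<And>S. S \<in> K \<Longrightarrow> Q S \<subseteq> ?H \<and> S = ?X - ?Z (Q S)" by metis
    have "\<Union>K = (\<Union>S\<in>K. ?X - ?Z (Q S))" using * by auto
    also have "\<dots> = ?X - ?Z (\<Union>S\<in>K. Q S)" by (auto simp: proj_zero_locus_def)
    finally show "\<exists>P\<subseteq>?H. \<Union>K = ?X - ?Z P" using * by (metis UN_least)
  qed
  then show ?thesis unfolding proj_zariski_def by simp
qed

end

theory Submission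
  imports Defs
begin

text \<open>
  Write \<open>A\<^sub>m\<close> for the span of the subspaces at \<open>m\<close> generic points of \<open>V\<close>, and let \<open>d m\<close> be the dimension
  of the intersection of \<open>A\<^sub>m\<close> with \<open>U\<^sub>y\<close> for a generic \<open>y\<close>. The values of \<open>m\<close> to be excluded are those for
  which \<open>d m\<close> is positive and \<open>A\<^sub>m\<close> is not the whole of \<open>L\<close>. The heart of the matter is that for such
  \<open>m\<close> the dimension \<open>d m\<close> is strictly smaller than \<open>d (m + 1)\<close>. Since \<open>d\<close> is bounded by the
  dimension \<open>N'\<close> of \<open>U\<^sub>y\<close>, the excluded values then form an interval of length at most \<open>N'\<close> (lemma
  \<open>exceptional_interval\<close>).

  Suppose that \<open>d (m + 1) \<le> d m\<close>. Adding a generic point does not change the intersection, hence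
  neither does exchanging one point for a new one, and after \<open>m\<close> exchanges all points have been
  replaced. So for a fixed generic \<open>y\<close> the intersection is the same for two independent generic tuples,
  and if \<open>d m\<close> is positive, some fixed nonzero vector lies in the span at a generic tuple (lemma
  \<open>persistent_nonzero\<close>). The vectors with this property form a subspace of \<open>L\<close>, which by equivariance
  is \<open>G\<close>-invariant. By irreducibility it is \<open>L\<close>, and as finitely many vectors span \<open>L\<close>, the
  generic span \<open>A\<^sub>m\<close> is \<open>L\<close>.

  To make sense of generic dimensions, two facts are needed. First, the points \<open>x\<^sub>i\<close> and \<open>y\<close> vary in an
  irreducible space (lemma \<open>irreducible_seq_space\<close>). Second, spans of the subspaces \<open>T[x\<^sub>i]\<close> and
  \<open>U[y]\<close> have a dimension that is lower semicontinuous (lemma \<open>dim_lower_semicontinuous\<close>). The second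
  fact rests on polynomial sections: through every vector of every \<open>T[x]\<close> there is a polynomial map
  whose values at all points of \<open>V\<close> stay in the family (lemma \<open>algebraic_map_globally_generated\<close>).
\<close>

section \<open>Zariski topologies and generic properties\<close>

lemma topspace_zariski [simp]: "topspace (zariski C) = UNIV"
proof -
  have "openin (zariski C) UNIV"
    unfolding openin_zariski
    by (rule exI[of _ "{\<lambda>_. 1}"]) (auto simp: zero_locus_def poly_funs.const)
  then show ?thesis using openin_subset by blast
qed

lemma openin_zariski_nonvanishing:
  assumes "p \<in> poly_funs C"
  shows "openin (subtopology (zariski C) X) {x \<in> X. p x \<noteq> 0}"
proof -
  have "openin (zariski C) {x. p x \<noteq> 0}"
    unfolding openin_zariski using assms by (intro exI[of _ "{p}"]) (auto simp: zero_locus_def)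
  then show ?thesis unfolding openin_subtopology by blast
qed

lemma openin_zariskiE:
  assumes "openin (subtopology (zariski C) X) S" "x \<in> S"
  obtains p where "p \<in> poly_funs C" "p x \<noteq> 0" "\<And>y. y \<in> X \<Longrightarrow> p y \<noteq> 0 \<Longrightarrow> y \<in> S"
proof -
  obtain P where P: "P \<subseteq> poly_funs C" "S = - zero_locus P \<inter> X"
    using assms(1) unfolding openin_subtopology openin_zariski by blast
  then obtain p where "p \<in> P" "p x \<noteq> 0" using assms(2) by (auto simp: zero_locus_def)
  then show thesis using P by (intro that[of p]) (auto simp: zero_locus_def)
qed

lemma poly_funs_compose:
  assumes "p \<in> poly_funs C" and "\<And>f. f \<in> C \<Longrightarrow> (\<lambda>x. f (\<phi> x)) \<in> poly_funs D"
  shows "(\<lambda>x. p (\<phi> x)) \<in> poly_funs D"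
  using assms(1) by induction (auto intro: poly_funs.intros assms(2))

lemma poly_funs_mono:
  assumes "p \<in> poly_funs C" "C \<subseteq> D"
  shows "p \<in> poly_funs D"
  using assms(1) by induction (use assms(2) in \<open>auto intro: poly_funs.intros\<close>)

text \<open>
  Pulling back the generators \<open>C\<close> to polynomial functions pulls back all basic open sets to basic
  open sets. All the continuous maps below are of this kind: substitutions of coordinates.
\<close>

lemma continuous_map_zariski:
  assumes "\<And>f. f \<in> C \<Longrightarrow> (\<lambda>x. f (\<phi> x)) \<in> poly_funs D" and "\<phi> \<in> Y \<rightarrow> X"
  shows "continuous_map (subtopology (zariski D) Y) (subtopology (zariski C) X) \<phi>"
  unfolding continuous_map_def
proof (intro conjI allI impI)
  show "\<phi> \<in> topspace (subtopology (zariski D) Y) \<rightarrow> topspace (subtopology (zariski C) X)"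
    using assms(2) by simp
  fix S assume S: "openin (subtopology (zariski C) X) S"
  let ?Z = "{x \<in> topspace (subtopology (zariski D) Y). \<phi> x \<in> S}"
  have "\<exists>R. openin (subtopology (zariski D) Y) R \<and> x \<in> R \<and> R \<subseteq> ?Z" if x: "x \<in> ?Z" for x
  proof -
    obtain p where p: "p \<in> poly_funs C" "p (\<phi> x) \<noteq> 0" "\<And>y. y \<in> X \<Longrightarrow> p y \<noteq> 0 \<Longrightarrow> y \<in> S"
      using openin_zariskiE[OF S] x by blast
    have "openin (subtopology (zariski D) Y) {x \<in> Y. p (\<phi> x) \<noteq> 0}"
      by (rule openin_zariski_nonvanishing[OF poly_funs_compose[OF p(1) assms(1)]])
    then show ?thesis using p x assms(2) by (intro exI[of _ "{x \<in> Y. p (\<phi> x) \<noteq> 0}"]) auto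
  qed
  then show "openin (subtopology (zariski D) Y) ?Z" by (subst openin_subopen) blast
qed

lemma irreducible_space_Int_nonempty:
  assumes X: "irreducible_space X" and S: "openin X S" "S \<noteq> {}" and R: "openin X R" "R \<noteq> {}"
  shows "S \<inter> R \<noteq> {}"
proof
  assume "S \<inter> R = {}"
  then have "(topspace X - S) \<union> (topspace X - R) = topspace X" by blast
  moreover have "closedin X (topspace X - S)" "closedin X (topspace X - R)" using S R by auto
  ultimately have "topspace X - S = topspace X \<or> topspace X - R = topspace X"
    using X unfolding irreducible_space_def by metis
  then show False using openin_subset[OF S(1)] openin_subset[OF R(1)] S(2) R(2) by blast
qed

text \<open>
  Irreducibility in algebraic terms: the polynomial functions on \<open>X\<close> have no zero divisors.
\<close>

lemma irreducible_spaceI_poly: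
  assumes "X \<noteq> {}"
    and meet: "\<And>p q x y. p \<in> poly_funs C \<Longrightarrow> q \<in> poly_funs C \<Longrightarrow> x \<in> X \<Longrightarrow> y \<in> X \<Longrightarrow>
      p x \<noteq> 0 \<Longrightarrow> q y \<noteq> 0 \<Longrightarrow> \<exists>z\<in>X. p z \<noteq> 0 \<and> q z \<noteq> 0"
  shows "irreducible_space (subtopology (zariski C) X)" (is "irreducible_space ?X")
  unfolding irreducible_space_def
proof (intro conjI allI impI)
  show "topspace ?X \<noteq> {}" using assms(1) by simp
  fix A B assume AB: "closedin ?X A \<and> closedin ?X B \<and> A \<union> B = topspace ?X"
  show "A = topspace ?X \<or> B = topspace ?X"
  proof (rule ccontr)
    assume "\<not> ?thesis"
    then obtain x y where xy: "x \<in> X - A" "y \<in> X - B" using AB by auto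
    have "openin ?X (topspace ?X - A)" "openin ?X (topspace ?X - B)"
      by (rule openin_diff[OF openin_topspace], use AB in blast)+
    then have "openin ?X (X - A)" "openin ?X (X - B)" by simp_all
    then obtain p q where "p \<in> poly_funs C" "p x \<noteq> 0" "\<And>z. z \<in> X \<Longrightarrow> p z \<noteq> 0 \<Longrightarrow> z \<in> X - A"
      and "q \<in> poly_funs C" "q y \<noteq> 0" "\<And>z. z \<in> X \<Longrightarrow> q z \<noteq> 0 \<Longrightarrow> z \<in> X - B"
      using xy openin_zariskiE[of C X "X - A" x] openin_zariskiE[of C X "X - B" y] by metis
    with meet[of p q x y] xy have "\<exists>z\<in>X. z \<notin> A \<union> B" by blast
    then show False using AB by auto
  qed
qed

lemma generically_mono:
  assumes "generically X P" and "\<And>x. x \<in> topspace X \<Longrightarrow> P x \<Longrightarrow> Q x"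
  shows "generically X Q"
  using assms openin_subset[of X] unfolding generically_def by (metis subsetD)

lemma generically_conj:
  assumes "irreducible_space X" "generically X P" "generically X Q"
  shows "generically X (\<lambda>x. P x \<and> Q x)"
proof -
  obtain S R where "openin X S" "S \<noteq> {}" "\<forall>x\<in>S. P x" "openin X R" "R \<noteq> {}" "\<forall>x\<in>R. Q x"
    using assms(2,3) unfolding generically_def by blast
  then show ?thesis
    using irreducible_space_Int_nonempty[OF assms(1), of S R] unfolding generically_def
    by (intro exI[of _ "S \<inter> R"]) auto
qed

lemma generically_const:
  assumes "irreducible_space X" "\<And>x. x \<in> topspace X \<Longrightarrow> P x"
  shows "generically X P"
  using assms unfolding generically_def irreducible_space_def by blast

lemma generically_ball:
  assumes "irreducible_space X" "finite I" "\<And>i. i \<in> I \<Longrightarrow> generically X (P i)"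
  shows "generically X (\<lambda>x. \<forall>i\<in>I. P i x)"
  using assms(2,3)
proof (induction I)
  case empty
  then show ?case using generically_const[OF assms(1)] by simp
next
  case (insert i I)
  then show ?case using generically_conj[OF assms(1), of "P i" "\<lambda>x. \<forall>i\<in>I. P i x"] by simp
qed

lemma generically_exists:
  assumes "generically X P"
  obtains x where "x \<in> topspace X" "P x"
  using assms openin_subset unfolding generically_def by blast

text \<open>
  Genericity survives a pullback as soon as a single point lands in the open set that witnesses it.
  Surjectivity is too much to ask of slice inclusions, which are not even dominant; this is why the
  witness \<open>S\<close> appears explicitly.
\<close>

lemma generically_pullback:
  assumes \<phi>: "continuous_map Y X \<phi>" and S: "openin X S" "\<And>x. x \<in> S \<Longrightarrow> P x"
    and y: "y \<in> topspace Y" "\<phi> y \<in> S"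
  shows "generically Y (\<lambda>y. P (\<phi> y))"
  unfolding generically_def
  using openin_continuous_map_preimage[OF \<phi> S(1)] S(2) y by blast

lemma generically_pullback_surj:
  assumes \<phi>: "continuous_map Y X \<phi>" and surj: "topspace X \<subseteq> \<phi> ` topspace Y"
    and "generically X P"
  shows "generically Y (\<lambda>y. P (\<phi> y))"
proof -
  obtain S x where S: "openin X S" "x \<in> S" "\<forall>x\<in>S. P x" using assms(3) unfolding generically_def by blast
  then obtain y where "y \<in> topspace Y" "\<phi> y = x" using surj openin_subset by blast
  then show ?thesis using generically_pullback[OF \<phi> S(1)] S by blast
qed

section \<open>Polynomial maps into vector spaces\<close>

definition poly_map :: "('x \<Rightarrow> complex) set \<Rightarrow> (complex \<Rightarrow> 'a::ab_group_add \<Rightarrow> 'a) \<Rightarrow> ('x \<Rightarrow> 'a) \<Rightarrow> bool"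
  where "poly_map C s \<sigma> \<longleftrightarrow> (\<forall>f\<in>linear_functionals s. (\<lambda>x. f (\<sigma> x)) \<in> poly_funs C)"

lemma poly_mapD: "poly_map C s \<sigma> \<Longrightarrow> f \<in> linear_functionals s \<Longrightarrow> (\<lambda>x. f (\<sigma> x)) \<in> poly_funs C"
  unfolding poly_map_def by blast

lemma linear_functional_add: "f \<in> linear_functionals s \<Longrightarrow> f (x + y) = f x + f y"
  and linear_functional_scale: "f \<in> linear_functionals s \<Longrightarrow> f (s c x) = c * f x"
  unfolding linear_functionals_def Vector_Spaces.linear_iff by auto

lemma linear_functional_zero: "f \<in> linear_functionals s \<Longrightarrow> f 0 = 0"
  using linear_functional_add[of f s 0 0] by simp

lemma linear_functional_diff: "f \<in> linear_functionals s \<Longrightarrow> f (x - y) = f x - f y"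
  using linear_functional_add[of f s "x - y" y] by simp

lemma linear_functional_sum: "f \<in> linear_functionals s \<Longrightarrow> f (\<Sum>j\<in>J. g j) = (\<Sum>j\<in>J. f (g j))"
  by (induction J rule: infinite_finite_induct)
    (simp_all add: linear_functional_zero linear_functional_add)

lemma vector_space_complex: "vector_space ((*) :: complex \<Rightarrow> complex \<Rightarrow> complex)"
  by unfold_locales (simp_all add: algebra_simps)

lemma linear_functional_separates:
  assumes "vector_space s" "v \<noteq> 0"
  obtains f where "f \<in> linear_functionals s" "f v \<noteq> 0"
proof -
  interpret vector_space_pair s "(*) :: complex \<Rightarrow> complex \<Rightarrow> complex"
    using assms(1) vector_space_complex by (simp add: vector_space_pair_def)
  have "vs1.independent {v}" using assms(2) by simp
  then obtain g where "Vector_Spaces.linear s (*) g" "\<forall>x\<in>{v}. g x = (1::complex)"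
    using linear_independent_extend[of "{v}" "\<lambda>_. 1"] by blast
  then show thesis using that[of g] by (simp add: linear_functionals_def)
qed

lemma poly_map_const: "poly_map C s (\<lambda>_. v)"
  unfolding poly_map_def by (simp add: poly_funs.const)

lemma poly_map_add: "poly_map C s \<sigma> \<Longrightarrow> poly_map C s \<tau> \<Longrightarrow> poly_map C s (\<lambda>x. \<sigma> x + \<tau> x)"
  unfolding poly_map_def by (auto simp: linear_functional_add intro: poly_funs.add)

lemma poly_map_scale: "p \<in> poly_funs C \<Longrightarrow> poly_map C s \<sigma> \<Longrightarrow> poly_map C s (\<lambda>x. s (p x) (\<sigma> x))"
  unfolding poly_map_def by (auto simp: linear_functional_scale intro: poly_funs.mult)

lemma poly_map_diff:
  assumes "poly_map C s \<sigma>" "poly_map C s \<tau>"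
  shows "poly_map C s (\<lambda>x. \<sigma> x - \<tau> x)"
  unfolding poly_map_def
proof
  fix f assume f: "f \<in> linear_functionals s"
  have "(\<lambda>x. f (\<sigma> x) + (- 1) * f (\<tau> x)) \<in> poly_funs C"
    by (intro poly_funs.add poly_funs.mult poly_funs.const poly_mapD[OF assms(1) f] poly_mapD[OF assms(2) f])
  then show "(\<lambda>x. f (\<sigma> x - \<tau> x)) \<in> poly_funs C" by (simp add: linear_functional_diff[OF f])
qed

lemma poly_map_sum:
  assumes "\<And>j. j \<in> J \<Longrightarrow> poly_map C s (\<sigma> j)"
  shows "poly_map C s (\<lambda>x. \<Sum>j\<in>J. \<sigma> j x)"
  using assms
  by (induction J rule: infinite_finite_induct) (simp_all add: poly_map_const poly_map_add)

lemma poly_map_ident: "poly_map (linear_functionals s) s (\<lambda>x. x)"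
  unfolding poly_map_def by (auto intro: poly_funs.coord)

lemma poly_map_linear:
  assumes "poly_map C s \<sigma>" "Vector_Spaces.linear s t g"
  shows "poly_map C t (\<lambda>x. g (\<sigma> x))"
  unfolding poly_map_def
proof
  fix f assume "f \<in> linear_functionals t"
  then have "Vector_Spaces.linear s (*) (\<lambda>x. f (g x))"
    using Vector_Spaces.linear_compose[OF assms(2), of "(*)" f] by (simp add: linear_functionals_def o_def)
  then show "(\<lambda>x. f (g (\<sigma> x))) \<in> poly_funs C"
    using poly_mapD[OF assms(1), of "\<lambda>x. f (g x)"] by (simp add: linear_functionals_def)
qed

section \<open>Sequences of points of V together with a point of V'\<close>

text \<open>
  All tuple spaces are treated at once by working with infinite sequences. Then the rank conditions
  for different numbers of points, and for different windows of the same sequence, live on one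
  irreducible space and can be imposed simultaneously; shifting a sequence is a self-map of this
  space. Every polynomial function still involves only finitely many of the coordinates.
\<close>

definition seq_coords :: "(complex \<Rightarrow> 'a::ab_group_add \<Rightarrow> 'a) \<Rightarrow> (complex \<Rightarrow> 'c::ab_group_add \<Rightarrow> 'c) \<Rightarrow>
    ((nat \<Rightarrow> 'a) \<times> 'c \<Rightarrow> complex) set"
  where "seq_coords s s' = (\<Union>m. tuple_coords m s s')"

abbreviation seq_space where
  "seq_space s V s' V' \<equiv> subtopology (zariski (seq_coords s s')) ((UNIV \<rightarrow> V) \<times> V')"

lemma poly_map_tuple_nth: "i < m \<Longrightarrow> poly_map (tuple_coords m s s') s (\<lambda>x. fst x i)"
  unfolding poly_map_def tuple_coords_def split_def by (auto intro!: poly_funs.coord)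

lemma poly_map_tuple_snd: "poly_map (tuple_coords m s s') s' snd"
  unfolding poly_map_def tuple_coords_def split_def by (auto intro!: poly_funs.coord)

lemma poly_map_seq_nth: "poly_map (seq_coords s s') s (\<lambda>x. fst x i)"
  and poly_map_seq_snd: "poly_map (seq_coords s s') s' snd"
proof -
  have *: "tuple_coords m s s' \<subseteq> seq_coords s s'" for m unfolding seq_coords_def by blast
  show "poly_map (seq_coords s s') s (\<lambda>x. fst x i)"
    using poly_map_tuple_nth[of i "Suc i" s s'] poly_funs_mono[OF _ *] unfolding poly_map_def by blast
  show "poly_map (seq_coords s s') s' snd"
    using poly_map_tuple_snd[of 0 s s'] poly_funs_mono[OF _ *] unfolding poly_map_def by blast
qed

lemma seq_coords_cases:
  assumes "f \<in> seq_coords s s'"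
  obtains i g where "g \<in> linear_functionals s" "f = (\<lambda>x. g (fst x i))"
    | g where "g \<in> linear_functionals s'" "f = (\<lambda>x. g (snd x))"
  using assms unfolding seq_coords_def tuple_coords_def split_def by blast

lemma seq_coords_pullback:
  assumes "\<And>i. poly_map D s (\<lambda>x. fst (\<phi> x) i)" "poly_map D s' (\<lambda>x. snd (\<phi> x))"
    and "f \<in> seq_coords s s'"
  shows "(\<lambda>x. f (\<phi> x)) \<in> poly_funs D"
  using assms(3) by (cases rule: seq_coords_cases) (auto intro: poly_mapD[OF assms(1)] poly_mapD[OF assms(2)])

lemma continuous_map_into_seq_space:
  assumes "\<And>i. poly_map D s (\<lambda>x. fst (\<phi> x) i)" "poly_map D s' (\<lambda>x. snd (\<phi> x))"
    and "\<phi> \<in> Y \<rightarrow> (UNIV \<rightarrow> V) \<times> V'"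
  shows "continuous_map (subtopology (zariski D) Y) (seq_space s V s' V') \<phi>"
  by (rule continuous_map_zariski[OF seq_coords_pullback[OF assms(1,2)] assms(3)])

lemma seq_poly_finitely_many_coords:
  assumes "p \<in> poly_funs (seq_coords s s')"
  obtains M where "\<And>z z' y. (\<And>i. i < M \<Longrightarrow> z i = z' i) \<Longrightarrow> p (z, y) = p (z', y)"
proof -
  have "\<exists>M. \<forall>z z' y. (\<forall>i<M. z i = z' i) \<longrightarrow> p (z, y) = p (z', y)"
    using assms
  proof induction
    case (const c)
    then show ?case by simp
  next
    case (coord f)
    then show ?case
    proof (cases rule: seq_coords_cases)
      case (1 i g)
      then show ?thesis by (auto intro!: exI[of _ "Suc i"])
    qed simp
  next
    case (add p q)
    then obtain M K where "\<forall>z z' y. (\<forall>i<M. z i = z' i) \<longrightarrow> p (z, y) = p (z', y)"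
      "\<forall>z z' y. (\<forall>i<K. z i = z' i) \<longrightarrow> q (z, y) = q (z', y)" by blast
    then show ?case by (intro exI[of _ "max M K"]) (metis less_max_iff_disj)
  next
    case (mult p q)
    then obtain M K where "\<forall>z z' y. (\<forall>i<M. z i = z' i) \<longrightarrow> p (z, y) = p (z', y)"
      "\<forall>z z' y. (\<forall>i<K. z i = z' i) \<longrightarrow> q (z, y) = q (z', y)" by blast
    then show ?case by (intro exI[of _ "max M K"]) (metis less_max_iff_disj)
  qed
  then show thesis using that by blast
qed

lemma irreducible_common_nonvanishing:
  assumes X: "irreducible_space (subtopology (zariski C) X)"
    and "p \<in> poly_funs C" "q \<in> poly_funs C" "x \<in> X" "p x \<noteq> 0" "y \<in> X" "q y \<noteq> 0"
  obtains z where "z \<in> X" "p z \<noteq> 0" "q z \<noteq> 0"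
proof -
  have "{x \<in> X. p x \<noteq> 0} \<inter> {x \<in> X. q x \<noteq> 0} \<noteq> {}"
    by (rule irreducible_space_Int_nonempty[OF X])
      (use assms in \<open>auto intro: openin_zariski_nonvanishing\<close>)
  then show thesis using that by blast
qed

text \<open>
  Let \<open>p\<close> be nonzero at \<open>(z1, y1)\<close> and \<open>q\<close> at \<open>(z2, y2)\<close>. One coordinate at a time, the two points
  can be made to agree: as functions of that coordinate alone, both polynomials are nonzero somewhere
  on an irreducible variety, hence have a common point where they are nonzero. The process stops
  because \<open>q\<close> depends on finitely many coordinates only.
\<close>

lemma irreducible_seq_space:
  assumes V: "irreducible_space (zariski_on s V)" and V': "irreducible_space (zariski_on s' V')"
  shows "irreducible_space (seq_space s V s' V')"
proof (rule irreducible_spaceI_poly)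
  have "V \<noteq> {}" "V' \<noteq> {}" using V V' by (auto simp: irreducible_space_def)
  then show "(UNIV \<rightarrow> V) \<times> V' \<noteq> {}" by auto
next
  fix p q x y
  assume p: "p \<in> poly_funs (seq_coords s s')" and q: "q \<in> poly_funs (seq_coords s s')"
    and x: "x \<in> (UNIV \<rightarrow> V) \<times> V'" "p x \<noteq> 0" and y: "y \<in> (UNIV \<rightarrow> V) \<times> V'" "q y \<noteq> 0"
  obtain z1 y1 where x_eq: "x = (z1, y1)" by (cases x)
  obtain z2 y2 where y_eq: "y = (z2, y2)" by (cases y)
  obtain M where M: "\<And>z z' y. (\<And>i. i < M \<Longrightarrow> z i = z' i) \<Longrightarrow> q (z, y) = q (z', y)"
    using seq_poly_finitely_many_coords[OF q] by metis
  have slice': "(\<lambda>y. r (z, y)) \<in> poly_funs (linear_functionals s')"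
    if "r \<in> poly_funs (seq_coords s s')" for r z
    by (rule poly_funs_compose[OF that]) (erule seq_coords_pullback[rotated 2];
      simp add: poly_map_const poly_map_ident)
  have slice: "(\<lambda>t. r (z(k := t), y)) \<in> poly_funs (linear_functionals s)"
    if "r \<in> poly_funs (seq_coords s s')" for r z k y
  proof (rule poly_funs_compose[OF that], erule seq_coords_pullback[rotated 2])
    show "poly_map (linear_functionals s) s (\<lambda>t. fst (z(k := t), y) i)" for i
      by (cases "i = k") (simp_all add: poly_map_const poly_map_ident)
  qed (simp add: poly_map_const)
  \<comment> \<open>Invariant: \<open>p\<close> is nonzero at \<open>(z, y)\<close>, and \<open>q\<close> at the point whose first \<open>k\<close> coordinates are
    already those of \<open>z\<close> while the others are still those of \<open>z2\<close>.\<close>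
  define merge where "merge k z = (\<lambda>i. if i < k then z i else z2 i)" for k :: nat and z
  have "\<exists>z y. z \<in> UNIV \<rightarrow> V \<and> y \<in> V' \<and> p (z, y) \<noteq> 0 \<and> q (merge k z, y) \<noteq> 0" for k
  proof (induction k)
    case 0
    obtain y where "y \<in> V'" "p (z1, y) \<noteq> 0" "q (z2, y) \<noteq> 0"
      by (rule irreducible_common_nonvanishing[OF V' slice'[OF p, of z1] slice'[OF q, of z2], of y1 y2])
        (use x y x_eq y_eq in auto)
    then show ?case using x x_eq by (intro exI[of _ z1] exI[of _ y]) (auto simp: merge_def)
  next
    case (Suc k)
    then obtain z y where zy: "z \<in> UNIV \<rightarrow> V" "y \<in> V'" "p (z, y) \<noteq> 0" "q (merge k z, y) \<noteq> 0" by blast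
    have upd: "merge (Suc k) (z(k := t)) = (merge k z)(k := t)" for t by (auto simp: merge_def fun_eq_iff)
    have self: "z(k := z k) = z" "(merge k z)(k := z2 k) = merge k z" by (auto simp: merge_def fun_eq_iff)
    obtain t where "t \<in> V" "p (z(k := t), y) \<noteq> 0" "q ((merge k z)(k := t), y) \<noteq> 0"
      by (rule irreducible_common_nonvanishing[OF V slice[OF p, of z k y] slice[OF q, of "merge k z" k y],
            of "z k" "z2 k"]) (use zy self y y_eq in auto)
    moreover have "z(k := t) \<in> UNIV \<rightarrow> V" using zy(1) \<open>t \<in> V\<close> by auto
    ultimately show ?case using zy(2) upd by metis
  qed
  then obtain z y where "z \<in> UNIV \<rightarrow> V" "y \<in> V'" "p (z, y) \<noteq> 0" "q (merge M z, y) \<noteq> 0" by blast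
  moreover have "q (merge M z, y) = q (z, y)" by (rule M) (simp add: merge_def)
  ultimately show "\<exists>z\<in>(UNIV \<rightarrow> V) \<times> V'. p z \<noteq> 0 \<and> q z \<noteq> 0" by (intro bexI[of _ "(z, y)"]) auto
qed

section \<open>Families of subspaces generated by polynomial sections\<close>

text \<open>
  This form of algebraicity of a family of subspaces passes to pullbacks and to sums, whereas being an
  algebraic map to a Grassmannian does not pass to sums, because the dimension of a sum can jump.
\<close>

definition globally_generated ::
    "('x \<Rightarrow> complex) set \<Rightarrow> 'x set \<Rightarrow> (complex \<Rightarrow> 'l::ab_group_add \<Rightarrow> 'l) \<Rightarrow> ('x \<Rightarrow> 'l set) \<Rightarrow> bool"
  where "globally_generated C X s F \<longleftrightarrow>
    (\<forall>x0\<in>X. \<forall>w\<in>F x0. \<exists>\<sigma>. poly_map C s \<sigma> \<and> (\<forall>x\<in>X. \<sigma> x \<in> F x) \<and> \<sigma> x0 = w)"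

lemma globally_generatedE:
  assumes "globally_generated C X s F" "x0 \<in> X" "w \<in> F x0"
  obtains \<sigma> where "poly_map C s \<sigma>" "\<And>x. x \<in> X \<Longrightarrow> \<sigma> x \<in> F x" "\<sigma> x0 = w"
  using assms unfolding globally_generated_def by blast

lemma globally_generated_pullback:
  assumes F: "globally_generated C X s F" and "\<phi> \<in> Y \<rightarrow> X"
    and pull: "\<And>p. p \<in> C \<Longrightarrow> (\<lambda>y. p (\<phi> y)) \<in> poly_funs D"
  shows "globally_generated D Y s (\<lambda>y. F (\<phi> y))"
  unfolding globally_generated_def
proof (intro ballI)
  fix y0 w assume "y0 \<in> Y" "w \<in> F (\<phi> y0)"
  then obtain \<sigma> where \<sigma>: "poly_map C s \<sigma>" "\<And>x. x \<in> X \<Longrightarrow> \<sigma> x \<in> F x" "\<sigma> (\<phi> y0) = w"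
    using globally_generatedE[OF F, of "\<phi> y0" w] assms(2) by blast
  have "poly_map D s (\<lambda>y. \<sigma> (\<phi> y))"
    unfolding poly_map_def
  proof
    fix f assume "f \<in> linear_functionals s"
    from poly_funs_compose[OF poly_mapD[OF \<sigma>(1) this] pull]
    show "(\<lambda>y. f (\<sigma> (\<phi> y))) \<in> poly_funs D" .
  qed
  then show "\<exists>\<tau>. poly_map D s \<tau> \<and> (\<forall>y\<in>Y. \<tau> y \<in> F (\<phi> y)) \<and> \<tau> y0 = w"
    using \<sigma> assms(2) by (intro exI[of _ "\<lambda>y. \<sigma> (\<phi> y)"]) auto
qed

lemma globally_generated_span_UN:
  assumes "vector_space s" and F: "\<And>i. i \<in> I \<Longrightarrow> globally_generated C X s (F i)"
  shows "globally_generated C X s (\<lambda>x. module.span s (\<Union>i\<in>I. F i x))"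
  unfolding globally_generated_def
proof (intro ballI)
  interpret vector_space s by fact
  fix x0 w assume x0: "x0 \<in> X" and w: "w \<in> span (\<Union>i\<in>I. F i x0)"
  from w show "\<exists>\<sigma>. poly_map C s \<sigma> \<and> (\<forall>x\<in>X. \<sigma> x \<in> span (\<Union>i\<in>I. F i x)) \<and> \<sigma> x0 = w"
  proof (induction rule: span_induct_alt)
    case base
    show ?case using poly_map_const[of C s 0] span_zero by (intro exI[of _ "\<lambda>_. 0"]) auto
  next
    case (step c v w)
    then obtain i \<sigma> where i: "i \<in> I" "v \<in> F i x0"
      and \<sigma>: "poly_map C s \<sigma>" "\<forall>x\<in>X. \<sigma> x \<in> span (\<Union>i\<in>I. F i x)" "\<sigma> x0 = w" by blast
    obtain \<tau> where \<tau>: "poly_map C s \<tau>" "\<And>x. x \<in> X \<Longrightarrow> \<tau> x \<in> F i x" "\<tau> x0 = v"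
      using globally_generatedE[OF F[OF i(1)] x0 i(2)] by blast
    have "poly_map C s (\<lambda>x. s c (\<tau> x) + \<sigma> x)"
      by (intro poly_map_add poly_map_scale poly_funs.const \<tau> \<sigma>)
    moreover have "s c (\<tau> x) + \<sigma> x \<in> span (\<Union>i\<in>I. F i x)" if "x \<in> X" for x
      using i(1) \<tau>(2)[OF that] \<sigma>(2) that by (intro span_add span_scale) (auto intro: span_base)
    ultimately show ?case
      using \<sigma>(3) \<tau>(3) by (intro exI[of _ "\<lambda>x. s c (\<tau> x) + \<sigma> x"]) auto
  qed
qed

lemma globally_generated_span_Un:
  assumes "vector_space s" "globally_generated C X s F" "globally_generated C X s F'"
  shows "globally_generated C X s (\<lambda>x. module.span s (F x \<union> F' x))"
  using globally_generated_span_UN[of s UNIV C X "\<lambda>b. if b then F else F'"] assms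
  by (simp add: UNIV_bool Un_commute)

section \<open>Semicontinuity of the dimension\<close>

text \<open>
  Gaussian elimination with polynomial entries. Choose a functional \<open>f\<close> that does not vanish on the
  pivot \<open>\<sigma> k x0\<close> and replace each other \<open>\<sigma> j\<close> by \<open>f(\<sigma> k) \<sigma> j - f(\<sigma> j) \<sigma> k\<close>, which lies in the kernel
  of \<open>f\<close>. This needs no division, so polynomiality is kept, and where \<open>f(\<sigma> k)\<close> is nonzero the
  independence of the new family is equivalent to that of the old one.
\<close>

lemma independence_open:
  fixes s :: "complex \<Rightarrow> 'l::ab_group_add \<Rightarrow> 'l"
  assumes "vector_space s" "finite J" "\<And>j. j \<in> J \<Longrightarrow> poly_map C s (\<sigma> j)"
    and "\<And>c. (\<Sum>j\<in>J. s (c j) (\<sigma> j x0)) = 0 \<Longrightarrow> \<forall>j\<in>J. c j = 0"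
  shows "\<exists>p\<in>poly_funs C. p x0 \<noteq> 0 \<and>
    (\<forall>x. p x \<noteq> 0 \<longrightarrow> (\<forall>c. (\<Sum>j\<in>J. s (c j) (\<sigma> j x)) = 0 \<longrightarrow> (\<forall>j\<in>J. c j = 0)))"
  using assms(2-)
proof (induction J arbitrary: \<sigma>)
  case empty
  show ?case using poly_funs.const[of 1 C] by (intro bexI[of _ "\<lambda>_. 1"]) auto
next
  interpret vector_space s by fact
  case (insert k J)
  have "\<sigma> k x0 \<noteq> 0"
  proof
    assume "\<sigma> k x0 = 0"
    then have "(\<Sum>j\<in>insert k J. s (if j = k then 1 else 0) (\<sigma> j x0)) = 0"
      by (intro sum.neutral) auto
    from insert.prems(2)[OF this] show False by simp
  qed
  then obtain f where f: "f \<in> linear_functionals s" "f (\<sigma> k x0) \<noteq> 0"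
    using linear_functional_separates[OF assms(1)] by blast
  define \<tau> where "\<tau> j x = s (f (\<sigma> k x)) (\<sigma> j x) - s (f (\<sigma> j x)) (\<sigma> k x)" for j x
  have elim: "(\<Sum>j\<in>J. s (c j) (\<tau> j x)) =
      s (f (\<sigma> k x)) (\<Sum>j\<in>J. s (c j) (\<sigma> j x)) - s (f (\<Sum>j\<in>J. s (c j) (\<sigma> j x))) (\<sigma> k x)" for c x
    by (simp add: \<tau>_def scale_right_diff_distrib sum_subtractf linear_functional_sum[OF f(1)]
        linear_functional_scale[OF f(1)] scale_sum_left scale_sum_right mult.commute)
  have "\<forall>j\<in>J. c j = 0" if c: "(\<Sum>j\<in>J. s (c j) (\<tau> j x0)) = 0" for c
  proof -
    \<comment> \<open>Expanding a relation \<open>c\<close> among the eliminated vectors gives the relation \<open>e\<close> among the old ones.\<close>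
    define e where "e j = (if j = k then - f (\<Sum>j\<in>J. s (c j) (\<sigma> j x0)) else f (\<sigma> k x0) * c j)" for j
    have "(\<Sum>j\<in>J. s (e j) (\<sigma> j x0)) = s (f (\<sigma> k x0)) (\<Sum>j\<in>J. s (c j) (\<sigma> j x0))"
      using insert.hyps(2) unfolding scale_sum_right by (intro sum.cong) (auto simp: e_def)
    then have "(\<Sum>j\<in>insert k J. s (e j) (\<sigma> j x0)) = 0"
      using insert.hyps c elim[of c x0] by (simp add: e_def scale_minus_left algebra_simps)
    from insert.prems(2)[OF this] have "e j = 0" if "j \<in> J" for j using that by blast
    moreover have "e j = f (\<sigma> k x0) * c j" if "j \<in> J" for j
      using that insert.hyps(2) by (auto simp: e_def)
    ultimately show ?thesis using f(2) by simp
  qed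
  moreover have "poly_map C s (\<tau> j)" if "j \<in> J" for j
    unfolding \<tau>_def[abs_def] using insert.prems(1) that
    by (intro poly_map_diff poly_map_scale poly_mapD[OF _ f(1)]) auto
  ultimately obtain p where p: "p \<in> poly_funs C" "p x0 \<noteq> 0"
    "\<And>x c. p x \<noteq> 0 \<Longrightarrow> (\<Sum>j\<in>J. s (c j) (\<tau> j x)) = 0 \<Longrightarrow> \<forall>j\<in>J. c j = 0"
    using insert.IH[of \<tau>] by blast
  have "(\<forall>j\<in>insert k J. c j = 0)"
    if x: "p x * f (\<sigma> k x) \<noteq> 0" and c: "(\<Sum>j\<in>insert k J. s (c j) (\<sigma> j x)) = 0" for x c
  proof -
    have c': "(\<Sum>j\<in>J. s (c j) (\<sigma> j x)) = - s (c k) (\<sigma> k x)"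
      using c insert.hyps by (simp add: eq_neg_iff_add_eq_0 add.commute)
    have "f (- s (c k) (\<sigma> k x)) = - (c k * f (\<sigma> k x))"
      using linear_functional_scale[OF f(1), of "- c k" "\<sigma> k x"] by simp
    then have "(\<Sum>j\<in>J. s (c j) (\<tau> j x)) = 0"
      unfolding elim c' by (simp add: mult.commute)
    then have "\<forall>j\<in>J. c j = 0" using p(3) x by auto
    moreover have "\<sigma> k x \<noteq> 0" using x linear_functional_zero[OF f(1)] by auto
    ultimately show ?thesis using c insert.hyps by simp
  qed
  moreover have "(\<lambda>x. p x * f (\<sigma> k x)) \<in> poly_funs C"
    using insert.prems(1) by (intro poly_funs.mult p poly_mapD[OF _ f(1)]) auto
  ultimately show ?case using p(2) f(2) by (intro bexI[of _ "\<lambda>x. p x * f (\<sigma> k x)"]) auto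
qed

text \<open>
  Sections through a basis of \<open>F x0\<close> remain independent near \<open>x0\<close>, and they remain in the family.
\<close>

lemma dim_lower_semicontinuous:
  fixes s :: "complex \<Rightarrow> 'l::ab_group_add \<Rightarrow> 'l"
  assumes "finite_dimensional_vector_space s B" and F: "globally_generated C X s F" and x0: "x0 \<in> X"
  shows "\<exists>p\<in>poly_funs C. p x0 \<noteq> 0 \<and>
    (\<forall>x\<in>X. p x \<noteq> 0 \<longrightarrow> vector_space.dim s (F x0) \<le> vector_space.dim s (F x))"
proof -
  interpret finite_dimensional_vector_space s B by fact
  obtain J where J: "J \<subseteq> F x0" "independent J" "card J = dim (F x0)"
    using basis_exists[of "F x0"] by metis
  have fin: "finite J" using finiteI_independent[OF J(2)] .
  have "\<forall>w\<in>J. \<exists>\<sigma>. poly_map C s \<sigma> \<and> (\<forall>x\<in>X. \<sigma> x \<in> F x) \<and> \<sigma> x0 = w"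
    using J(1) globally_generatedE[OF F x0] by (metis subsetD)
  then obtain \<sigma> where \<sigma>: "\<And>w. w \<in> J \<Longrightarrow> poly_map C s (\<sigma> w)"
    "\<And>w x. w \<in> J \<Longrightarrow> x \<in> X \<Longrightarrow> \<sigma> w x \<in> F x" "\<And>w. w \<in> J \<Longrightarrow> \<sigma> w x0 = w"
    by metis
  have "\<forall>j\<in>J. c j = 0" if "(\<Sum>j\<in>J. s (c j) (\<sigma> j x0)) = 0" for c
    using that J(2) \<sigma>(3) independent_explicit[of J] by simp
  then obtain p where p: "p \<in> poly_funs C" "p x0 \<noteq> 0"
    "\<And>x c. p x \<noteq> 0 \<Longrightarrow> (\<Sum>j\<in>J. s (c j) (\<sigma> j x)) = 0 \<Longrightarrow> \<forall>j\<in>J. c j = 0"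
    using independence_open[OF vector_space_axioms fin, of C \<sigma> x0] \<sigma>(1) by blast
  have "dim (F x0) \<le> dim (F x)" if x: "x \<in> X" "p x \<noteq> 0" for x
  proof -
    have inj: "inj_on (\<lambda>w. \<sigma> w x) J"
    proof (rule inj_onI, rule ccontr)
      fix u v assume uv: "u \<in> J" "v \<in> J" "\<sigma> u x = \<sigma> v x" "u \<noteq> v"
      define c where "c j = (if j = u then 1 else if j = v then - 1 else 0 :: complex)" for j
      have "(\<Sum>j\<in>J. s (c j) (\<sigma> j x)) = (\<Sum>j\<in>{u, v}. s (c j) (\<sigma> j x))"
        using uv fin by (intro sum.mono_neutral_right) (auto simp: c_def)
      also have "\<dots> = 0" using uv by (simp add: c_def scale_minus_left)
      finally show False using p(3)[OF x(2)] uv(1) by (fastforce simp: c_def)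
    qed
    have "independent ((\<lambda>w. \<sigma> w x) ` J)"
    proof (rule independent_if_scalars_zero)
      fix c v assume "(\<Sum>v\<in>(\<lambda>w. \<sigma> w x) ` J. s (c v) v) = 0" and v: "v \<in> (\<lambda>w. \<sigma> w x) ` J"
      then have "(\<Sum>w\<in>J. s (c (\<sigma> w x)) (\<sigma> w x)) = 0" by (simp add: sum.reindex[OF inj])
      then show "c v = 0" using p(3)[OF x(2)] v by fastforce
    qed (use fin in simp)
    then have "card ((\<lambda>w. \<sigma> w x) ` J) \<le> dim (F x)"
      using \<sigma>(2) x(1) by (intro independent_card_le_dim) auto
    then show ?thesis using J(3) card_image[OF inj] by simp
  qed
  then show ?thesis using p by blast
qed

lemma generic_dim:
  fixes s :: "complex \<Rightarrow> 'l::ab_group_add \<Rightarrow> 'l"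
  assumes "finite_dimensional_vector_space s B" and F: "globally_generated C X s F" and X: "X \<noteq> {}"
  obtains r where "generically (subtopology (zariski C) X) (\<lambda>x. vector_space.dim s (F x) = r)"
proof -
  interpret finite_dimensional_vector_space s B by fact
  let ?D = "(\<lambda>x. dim (F x)) ` X"
  have fin: "finite ?D" using dim_subset_UNIV by (intro finite_subset[of ?D "{..dimension}"]) auto
  then obtain x0 where x0: "x0 \<in> X" "dim (F x0) = Max ?D" using Max_in[of ?D] X by fastforce
  obtain p where p: "p \<in> poly_funs C" "p x0 \<noteq> 0" "\<forall>x\<in>X. p x \<noteq> 0 \<longrightarrow> dim (F x0) \<le> dim (F x)"
    using dim_lower_semicontinuous[OF assms(1) F x0(1)] by blast
  have "dim (F x) = Max ?D" if "x \<in> X" "p x \<noteq> 0" for x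
    using p(3) that x0(2) Max_ge[OF fin, of "dim (F x)"] by force
  then have "generically (subtopology (zariski C) X) (\<lambda>x. dim (F x) = Max ?D)"
    unfolding generically_def using openin_zariski_nonvanishing[OF p(1), of X] p(2) x0(1) by blast
  then show thesis by (rule that)
qed

section \<open>Algebraic maps to Grassmannians are generated by sections\<close>

context finite_dimensional_vector_space
begin

lemma subspace_complement_exists:
  assumes W: "subspace W"
  obtains E where "subspace E" "dim E + dim W = dim UNIV" "W \<inter> E = {0}"
proof -
  obtain A where A: "A \<subseteq> W" "independent A" "W \<subseteq> span A" "card A = dim W"
    using basis_exists[of W] by metis
  obtain B where B: "A \<subseteq> B" "independent B" "UNIV \<subseteq> span B"
    using maximal_independent_subset_extend[OF _ A(2), of UNIV] by auto
  let ?E = "span (B - A)"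
  have fin: "finite B" using finiteI_independent[OF B(2)] .
  have span_A: "span A = W" using A(1,3) W span_subspace by blast
  have "card B = dim UNIV" using basis_card_eq_dim[of B UNIV] B by auto
  moreover have "dim ?E = card (B - A)"
    using dim_span_eq_card_independent[OF independent_mono[OF B(2)]] by blast
  ultimately have dims: "dim ?E + dim W = dim UNIV"
    using A(4) card_Diff_subset[OF finite_subset[OF B(1) fin] B(1)] card_mono[OF fin B(1)] by simp
  have "A \<union> (B - A) = B" using B(1) by blast
  then have "{x + y |x y. x \<in> W \<and> y \<in> ?E} = UNIV"
    using span_Un[of A "B - A"] span_A B(3) by auto
  then have "dim UNIV + dim (W \<inter> ?E) = dim W + dim ?E"
    using dim_sums_Int[OF W subspace_span, of "B - A"] by metis
  then have "dim (W \<inter> ?E) = 0" using dims by linarith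
  then have "W \<inter> ?E \<subseteq> {0}" by (simp only: dim_eq_0)
  then have "W \<inter> ?E = {0}" using subspace_0[OF W] span_zero[of "B - A"] by blast
  then show thesis by (rule that[OF subspace_span dims])
qed

lemma
  assumes "subspace W" "subspace E" "dim E + dim W = dim UNIV" "W \<inter> E = {0}"
  shows proj_along_in: "proj_along W E v \<in> W"
    and proj_along_fixes: "v \<in> W \<Longrightarrow> proj_along W E v = v"
proof -
  have "dim {x + y |x y. x \<in> W \<and> y \<in> E} = dim UNIV"
    using dim_sums_Int[OF assms(1,2)] assms(3,4) by simp
  then have "{x + y |x y. x \<in> W \<and> y \<in> E} = UNIV"
    using subspace_dim_equal[OF subspace_sums[OF assms(1,2)] subspace_UNIV] by simp
  then obtain x y where v: "v = x + y" "x \<in> W" "y \<in> E" by blast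
  have unique: "w = w'" if "w \<in> W \<and> v - w \<in> E" "w' \<in> W \<and> v - w' \<in> E" for w w'
  proof -
    have "w - w' \<in> W" using that assms(1) subspace_diff by blast
    moreover have "w - w' = (v - w') - (v - w)" by simp
    then have "w - w' \<in> E" using that assms(2) subspace_diff by metis
    ultimately have "w - w' \<in> W \<inter> E" by blast
    then show ?thesis using assms(4) by simp
  qed
  have "\<exists>!w. w \<in> W \<and> v - w \<in> E" using v unique by (intro ex1I[of _ x]) auto
  from theI'[OF this] show "proj_along W E v \<in> W" by (simp add: proj_along_def)
  show "proj_along W E v = v" if "v \<in> W"
    unfolding proj_along_def using that unique subspace_0[OF assms(2)] by (intro the_equality) auto
qed

end

text \<open>
  An open subset of the projective variety contains the nonvanishing locus of some homogeneous
  \<open>r\<close> around a given point. The additional factor, a linear functional, makes \<open>h\<close> vanish at the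
  origin, the only point of the cone that does not represent a point of the projective variety.
\<close>

lemma proj_open_nonvanishing:
  assumes s: "vector_space s" and S: "openin (proj_zariski_on s V) S"
    and x0: "x0 \<noteq> 0" "module.span s {x0} \<in> S"
  obtains h where "h \<in> poly_funs (linear_functionals s)" "h x0 \<noteq> 0"
    and "\<And>x. x \<in> V \<Longrightarrow> h x \<noteq> 0 \<Longrightarrow> x \<noteq> 0 \<and> module.span s {x} \<in> S"
proof -
  interpret vector_space s by fact
  obtain P where P: "P \<subseteq> (\<Union>d. homogeneous_polys s d)"
    "S = (projectivization s UNIV - proj_zero_locus s P) \<inter> projectivization s V"
    using S unfolding openin_subtopology openin_proj_zariski[OF s] by blast
  obtain r x where r: "r \<in> P" "x \<in> span {x0}" "r x \<noteq> 0"
    using x0(2) unfolding P(2) proj_zero_locus_def by blast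
  obtain d where d: "r \<in> homogeneous_polys s d" using P(1) r(1) by blast
  have "r x0 \<noteq> 0" using r(2,3) d unfolding span_singleton homogeneous_polys_def by auto
  obtain f where f: "f \<in> linear_functionals s" "f x0 \<noteq> 0"
    using linear_functional_separates[OF s x0(1)] by blast
  show thesis
  proof (rule that[of "\<lambda>x. r x * f x"])
    show "(\<lambda>x. r x * f x) \<in> poly_funs (linear_functionals s)"
      using d f by (auto simp: homogeneous_polys_def intro: poly_funs.intros)
    show "r x0 * f x0 \<noteq> 0" using \<open>r x0 \<noteq> 0\<close> f by simp
    fix x assume x: "x \<in> V" "r x * f x \<noteq> 0"
    have "x \<noteq> 0" using x(2) linear_functional_zero[OF f(1)] by auto
    moreover have "span {x} \<notin> proj_zero_locus s P"
      using x(2) r(1) span_base[of x "{x}"] unfolding proj_zero_locus_def by auto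
    ultimately show "x \<noteq> 0 \<and> span {x} \<in> S"
      using x(1) unfolding P(2) projectivization_def by blast
  qed
qed

text \<open>
  Multiplying by \<open>h\<close> clears the denominators of finitely many regular functions near \<open>x0\<close>; the
  local domains of the fractions are cut down along with it, because \<open>h\<close> also vanishes outside of them.
\<close>

lemma regular_common_denominator:
  assumes s: "vector_space s" and D: "openin (proj_zariski_on s V) D"
    and x0: "x0 \<noteq> 0" "module.span s {x0} \<in> D"
    and "finite J" "\<And>j. j \<in> J \<Longrightarrow> regular_on s V D (f j)"
  shows "\<exists>h\<in>poly_funs (linear_functionals s). h x0 \<noteq> 0 \<and>
    (\<forall>x\<in>V. h x \<noteq> 0 \<longrightarrow> x \<noteq> 0 \<and> module.span s {x} \<in> D) \<and>
    (\<forall>j\<in>J. \<exists>p\<in>poly_funs (linear_functionals s). \<forall>x\<in>V. h x \<noteq> 0 \<longrightarrow> h x * f j (module.span s {x}) = p x)"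
  using assms(5,6)
proof (induction J)
  case empty
  show ?case using proj_open_nonvanishing[OF s D x0] by (metis empty_iff)
next
  interpret vector_space s by fact
  let ?R = "poly_funs (linear_functionals s)"
  case (insert k J)
  then obtain h where h: "h \<in> ?R" "h x0 \<noteq> 0" "\<And>x. x \<in> V \<Longrightarrow> h x \<noteq> 0 \<Longrightarrow> x \<noteq> 0 \<and> span {x} \<in> D"
    "\<forall>j\<in>J. \<exists>p\<in>?R. \<forall>x\<in>V. h x \<noteq> 0 \<longrightarrow> h x * f j (span {x}) = p x" by auto
  obtain S d p q where S: "openin (proj_zariski_on s V) S" "span {x0} \<in> S"
    and pq: "p \<in> homogeneous_polys s d" "q \<in> homogeneous_polys s d"
      "\<forall>l\<in>S. \<forall>x\<in>l - {0}. q x \<noteq> 0 \<and> f k l = p x / q x"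
    using insert.prems[of k] x0(2) unfolding regular_on_def by (metis insertI1)
  obtain r where r: "r \<in> ?R" "r x0 \<noteq> 0" "\<And>x. x \<in> V \<Longrightarrow> r x \<noteq> 0 \<Longrightarrow> x \<noteq> 0 \<and> span {x} \<in> S"
    using proj_open_nonvanishing[OF s S(1) x0(1) S(2)] by blast
  have pqR: "p \<in> ?R" "q \<in> ?R" using pq(1,2) by (auto simp: homogeneous_polys_def)
  have frac: "q x \<noteq> 0 \<and> f k (span {x}) = p x / q x" if "x \<noteq> 0" "span {x} \<in> S" for x
    using that pq(3) span_base[of x "{x}"] by auto
  let ?h = "\<lambda>x. h x * (r x * q x)"
  have "?h \<in> ?R" by (intro poly_funs.mult h r pqR)
  moreover have "?h x0 \<noteq> 0" using h(2) r(2) frac[OF x0(1) S(2)] by simp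
  moreover have "\<exists>p\<in>?R. \<forall>x\<in>V. ?h x \<noteq> 0 \<longrightarrow> ?h x * f j (span {x}) = p x" if j: "j \<in> insert k J" for j
  proof (cases "j = k")
    case True
    have "?h x * f k (span {x}) = h x * (r x * p x)" if "x \<in> V" "?h x \<noteq> 0" for x
    proof -
      have "x \<noteq> 0" "span {x} \<in> S" using r(3)[OF that(1)] that(2) by auto
      from frac[OF this] show ?thesis by simp
    qed
    then show ?thesis
      unfolding True using poly_funs.mult[OF h(1) poly_funs.mult[OF r(1) pqR(1)]]
      by (intro bexI[of _ "\<lambda>x. h x * (r x * p x)"]) blast+
  next
    case False
    then obtain p' where p': "p' \<in> ?R" "\<forall>x\<in>V. h x \<noteq> 0 \<longrightarrow> h x * f j (span {x}) = p' x"
      using h(4) j by blast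
    show ?thesis
    proof (rule bexI)
      show "(\<lambda>x. p' x * (r x * q x)) \<in> ?R" by (intro poly_funs.mult p' r pqR)
      show "\<forall>x\<in>V. ?h x \<noteq> 0 \<longrightarrow> ?h x * f j (span {x}) = p' x * (r x * q x)"
        using p'(2) by (auto simp: mult_ac)
    qed
  qed
  moreover have "\<forall>x\<in>V. ?h x \<noteq> 0 \<longrightarrow> x \<noteq> 0 \<and> span {x} \<in> D" using h(3) by auto
  ultimately show ?case by (intro bexI[of _ ?h]) blast+
qed

text \<open>
  The family over the cone itself. The value \<open>{0}\<close> at the origin is what a section is bound to take
  there after multiplication with a polynomial that vanishes at the origin.
\<close>

definition fibre :: "(complex \<Rightarrow> 'a::ab_group_add \<Rightarrow> 'a) \<Rightarrow> ('a set \<Rightarrow> 'l::zero set) \<Rightarrow> 'a \<Rightarrow> 'l set"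
  where "fibre s T x = (if x = 0 then {0} else T (module.span s {x}))"

lemma algebraic_map_fibre_in_Gr:
  assumes "algebraic_map_to_Gr s V sL k T" "x \<in> V" "x \<noteq> 0"
  shows "T (module.span s {x}) \<in> Gr sL k"
  using assms unfolding algebraic_map_to_Gr_def projectivization_def by blast

lemma fibre_subspace:
  assumes "vector_space sL" "algebraic_map_to_Gr s V sL k T" "x \<in> V"
  shows "module.subspace sL (fibre s T x)"
proof -
  interpret vector_space sL by fact
  show ?thesis using algebraic_map_fibre_in_Gr[OF assms(2,3)] by (auto simp: fibre_def Gr_def)
qed

text \<open>
  Take the chart given by a complement \<open>E\<close> of \<open>T[x0]\<close>. Projecting \<open>w\<close> to \<open>T[x]\<close> along \<open>E\<close> is a rational
  section through \<open>w\<close>, defined near \<open>x0\<close>. Multiplication with a common denominator \<open>h\<close> makes its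
  coordinates polynomial, and a second factor \<open>h\<close> makes it vanish where the projection is not under
  control, so that the result lies in the family everywhere.
\<close>

lemma algebraic_map_globally_generated:
  fixes sL :: "complex \<Rightarrow> 'l::ab_group_add \<Rightarrow> 'l"
  assumes s: "vector_space s" and L: "finite_dimensional_vector_space sL BL"
    and T: "algebraic_map_to_Gr s V sL k T"
  shows "globally_generated (linear_functionals s) V sL (fibre s T)"
  unfolding globally_generated_def
proof (intro ballI)
  interpret finite_dimensional_vector_space sL BL by fact
  let ?R = "poly_funs (linear_functionals s)" and ?line = "\<lambda>x. module.span s {x}"
  fix x0 w assume x0: "x0 \<in> V" and w: "w \<in> fibre s T x0"
  have zero_in: "0 \<in> fibre s T x" if "x \<in> V" for x
    using fibre_subspace[OF vector_space_axioms T that] by (rule subspace_0)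
  show "\<exists>\<sigma>. poly_map (linear_functionals s) sL \<sigma> \<and> (\<forall>x\<in>V. \<sigma> x \<in> fibre s T x) \<and> \<sigma> x0 = w"
  proof (cases "x0 = 0")
    case True
    then show ?thesis using w zero_in poly_map_const[of _ sL 0]
      by (intro exI[of _ "\<lambda>_. 0"]) (auto simp: fibre_def)
  next
    case False
    have W: "subspace (T (?line x0))" "dim (T (?line x0)) = k"
      using algebraic_map_fibre_in_Gr[OF T x0 False] by (auto simp: Gr_def)
    obtain E where E: "subspace E" "dim E + k = dim UNIV" "T (?line x0) \<inter> E = {0}"
      using subspace_complement_exists[OF W(1)] W(2) by blast
    define D where "D = {l \<in> projectivization s V. T l \<in> Gr_chart sL k E}"
    have D: "openin (proj_zariski_on s V) D"
      and reg: "\<And>v f. f \<in> linear_functionals sL \<Longrightarrow> regular_on s V D (\<lambda>l. f (proj_along (T l) E v))"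
      using T E(1,2) unfolding algebraic_map_to_Gr_def D_def Let_def by blast+
    have x0D: "?line x0 \<in> D"
      using x0 False W E(3) unfolding D_def projectivization_def Gr_chart_def Gr_def by blast
    define coord where "coord b v = representation BL v b" for b v
    have coord: "coord b \<in> linear_functionals sL" for b
      unfolding coord_def[abs_def] linear_functionals_def
      using linear_representation[OF independent_Basis span_Basis] by simp
    have expand: "(\<Sum>b\<in>BL. sL (coord b v) b) = v" for v
      unfolding coord_def
      using sum_representation_eq[OF independent_Basis _ finite_Basis order.refl, of v] span_Basis by simp
    have reg': "regular_on s V D (\<lambda>l. coord b (proj_along (T l) E w))" for b
      by (rule reg[OF coord])
    obtain h where h: "h \<in> ?R" "h x0 \<noteq> 0" "\<And>x. x \<in> V \<Longrightarrow> h x \<noteq> 0 \<Longrightarrow> x \<noteq> 0 \<and> ?line x \<in> D"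
      and P: "\<forall>b\<in>BL. \<exists>p\<in>?R. \<forall>x\<in>V. h x \<noteq> 0 \<longrightarrow> h x * coord b (proj_along (T (?line x)) E w) = p x"
      using regular_common_denominator[OF s D False x0D finite_Basis,
          of "\<lambda>b l. coord b (proj_along (T l) E w)", OF reg']
      by (elim bexE conjE) blast
    from P have "\<exists>p. \<forall>b\<in>BL. p b \<in> ?R \<and>
        (\<forall>x\<in>V. h x \<noteq> 0 \<longrightarrow> h x * coord b (proj_along (T (?line x)) E w) = p b x)"
      unfolding Bex_def by (rule bchoice)
    then obtain p where p: "\<And>b. b \<in> BL \<Longrightarrow> p b \<in> ?R"
      "\<And>b x. b \<in> BL \<Longrightarrow> x \<in> V \<Longrightarrow> h x \<noteq> 0 \<Longrightarrow> h x * coord b (proj_along (T (?line x)) E w) = p b x"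
      by blast
    \<comment> \<open>The constant factor normalizes the value at \<open>x0\<close> to \<open>w\<close>.\<close>
    define \<sigma> where "\<sigma> x = (\<Sum>b\<in>BL. sL (1 / (h x0)\<^sup>2 * (h x * p b x)) b)" for x
    have "poly_map (linear_functionals s) sL \<sigma>"
      unfolding \<sigma>_def[abs_def]
      by (intro poly_map_sum poly_map_scale poly_map_const poly_funs.mult poly_funs.const h p)
    moreover have \<sigma>: "\<sigma> x = sL ((h x)\<^sup>2 / (h x0)\<^sup>2) (proj_along (T (?line x)) E w)"
      if "x \<in> V" "h x \<noteq> 0" for x
    proof -
      have "\<sigma> x = (\<Sum>b\<in>BL. sL ((h x)\<^sup>2 / (h x0)\<^sup>2) (sL (coord b (proj_along (T (?line x)) E w)) b))"
        unfolding \<sigma>_def using p(2)[OF _ that, symmetric]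
        by (intro sum.cong) (simp_all add: power2_eq_square mult_ac)
      also have "\<dots> = sL ((h x)\<^sup>2 / (h x0)\<^sup>2) (proj_along (T (?line x)) E w)"
        by (simp only: scale_sum_right[symmetric] expand)
      finally show ?thesis .
    qed
    moreover have "\<sigma> x \<in> fibre s T x" if x: "x \<in> V" for x
    proof (cases "h x = 0")
      case True
      then have "\<sigma> x = 0" by (simp add: \<sigma>_def)
      then show ?thesis using zero_in[OF x] by simp
    next
      case hx: False
      have nz: "x \<noteq> 0" and "?line x \<in> D" using h(3)[OF x hx] by auto
      then have "subspace (T (?line x))" "dim (T (?line x)) = k" "T (?line x) \<inter> E = {0}"
        unfolding D_def Gr_chart_def Gr_def by auto
      then have "sL c (proj_along (T (?line x)) E w) \<in> T (?line x)" for c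
        using E proj_along_in subspace_scale by metis
      then show ?thesis using \<sigma>[OF x hx] nz by (simp add: fibre_def)
    qed
    moreover have "\<sigma> x0 = w"
    proof -
      have "w \<in> T (?line x0)" using w False by (simp add: fibre_def)
      then have "proj_along (T (?line x0)) E w = w" using proj_along_fixes W E by metis
      then show ?thesis using \<sigma>[OF x0 h(2)] h(2) by simp
    qed
    ultimately show ?thesis by blast
  qed
qed

section \<open>Spans of a growing number of generic members\<close>

text \<open>
  The situation of the theorem with everything forgotten but the generating sections of the two
  families. The group enters only later, through the alternative in \<open>exceptional_interval\<close>.
\<close>

locale generated_families = finite_dimensional_vector_space sL BL
  for sL :: "complex \<Rightarrow> 'l::ab_group_add \<Rightarrow> 'l" and BL +
  fixes s :: "complex \<Rightarrow> 'v::ab_group_add \<Rightarrow> 'v" and V :: "'v set"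
    and s' :: "complex \<Rightarrow> 'w::ab_group_add \<Rightarrow> 'w" and V' :: "'w set"
    and F :: "'v \<Rightarrow> 'l set" and F' :: "'w \<Rightarrow> 'l set" and N' :: nat
  assumes irreducible: "irreducible_space (seq_space s V s' V')"
    and generated: "globally_generated (linear_functionals s) V sL F"
    and generated': "globally_generated (linear_functionals s') V' sL F'"
    and subspace': "y \<in> V' \<Longrightarrow> subspace (F' y)"
    and generic_dim': "generically (seq_space s V s' V') (\<lambda>x. dim (F' (snd x)) = N')"
begin

abbreviation "X \<equiv> seq_space s V s' V'"

abbreviation "everywhere \<equiv> (UNIV \<rightarrow> V) \<times> V'"

definition joined :: "nat \<Rightarrow> (nat \<Rightarrow> 'v) \<Rightarrow> 'l set"
  where "joined m z = span (\<Union>i<m. F (z i))"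

lemma joined_subspace: "subspace (joined m z)"
  unfolding joined_def by simp

lemma joined_mono: "m \<le> n \<Longrightarrow> joined m z \<subseteq> joined n z"
  unfolding joined_def by (intro span_mono UN_mono) auto

lemma joined_shift_subset: "joined m (\<lambda>i. z (Suc i)) \<subseteq> joined (Suc m) z"
  unfolding joined_def by (intro span_mono) fastforce

lemma joined_cong: "(\<And>i. i < m \<Longrightarrow> z i = z' i) \<Longrightarrow> joined m z = joined m z'"
  unfolding joined_def by auto

text \<open>
  By semicontinuity a sum has a generic dimension, and the dimension of an intersection is
  determined by those of the two spaces and of their sum.
\<close>

lemma generic_intersection_dim:
  obtains d where "generically X (\<lambda>x. dim (joined m (fst x) \<inter> F' (snd x)) = d)"
proof -
  have ne: "everywhere \<noteq> {}" using irreducible by (auto simp: irreducible_space_def)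
  have F: "globally_generated (seq_coords s s') everywhere sL (\<lambda>x. F (fst x i))" for i
    by (rule globally_generated_pullback[OF generated, of "\<lambda>x. fst x i"])
      (auto intro: poly_mapD[OF poly_map_seq_nth])
  have J: "globally_generated (seq_coords s s') everywhere sL (\<lambda>x. joined m (fst x))"
    unfolding joined_def by (rule globally_generated_span_UN[OF vector_space_axioms F])
  have F': "globally_generated (seq_coords s s') everywhere sL (\<lambda>x. F' (snd x))"
    by (rule globally_generated_pullback[OF generated', of snd]) (auto intro: poly_mapD[OF poly_map_seq_snd])
  note fd = finite_dimensional_vector_space_axioms
  obtain a where a: "generically X (\<lambda>x. dim (joined m (fst x)) = a)"
    using generic_dim[OF fd J ne] .
  obtain e where e: "generically X (\<lambda>x. dim (span (joined m (fst x) \<union> F' (snd x))) = e)"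
    using generic_dim[OF fd globally_generated_span_Un[OF vector_space_axioms J F'] ne] .
  have "generically X (\<lambda>x. dim (joined m (fst x) \<inter> F' (snd x)) = a + N' - e)"
  proof (rule generically_mono[OF generically_conj[OF irreducible generically_conj[OF irreducible a e] generic_dim']])
    fix x assume x: "x \<in> topspace X"
      and dims: "(dim (joined m (fst x)) = a \<and> dim (span (joined m (fst x) \<union> F' (snd x))) = e) \<and>
        dim (F' (snd x)) = N'"
    have U: "subspace (F' (snd x))" using subspace' x by auto
    have "span (joined m (fst x) \<union> F' (snd x)) = {u + v |u v. u \<in> joined m (fst x) \<and> v \<in> F' (snd x)}"
      unfolding span_Un using U joined_subspace by (simp add: span_eq_iff[THEN iffD2])
    then have "e + dim (joined m (fst x) \<inter> F' (snd x)) = a + N'"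
      using dim_sums_Int[OF joined_subspace[of m "fst x"] U] dims by metis
    then show "dim (joined m (fst x) \<inter> F' (snd x)) = a + N' - e" by simp
  qed
  then show thesis by (rule that)
qed

lemma generically_shift:
  assumes "generically X P"
  shows "generically X (\<lambda>x. P (\<lambda>i. fst x (i + k), snd x))"
proof (rule generically_pullback_surj[OF _ _ assms])
  show "continuous_map X X (\<lambda>x. (\<lambda>i. fst x (i + k), snd x))"
    by (rule continuous_map_into_seq_space) (auto intro: poly_map_seq_nth poly_map_seq_snd)
  show "topspace X \<subseteq> (\<lambda>x. (\<lambda>i. fst x (i + k), snd x)) ` topspace X"
  proof
    fix x assume "x \<in> topspace X"
    then show "x \<in> (\<lambda>x. (\<lambda>i. fst x (i + k), snd x)) ` topspace X"
      by (intro image_eqI[of _ _ "(\<lambda>i. fst x (i - k), snd x)"]) auto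
  qed
qed

text \<open>
  The vectors that lie in the span of \<open>m\<close> members in general position, where the open set of
  general positions may depend on the vector.
\<close>

definition persistent :: "nat \<Rightarrow> 'l set"
  where "persistent m = {w. generically X (\<lambda>x. w \<in> joined m (fst x))}"

lemma persistent_subspace: "subspace (persistent m)"
proof (rule subspaceI)
  show "0 \<in> persistent m"
    unfolding persistent_def using generically_const[OF irreducible] subspace_0[OF joined_subspace] by simp
  show "u + v \<in> persistent m" if "u \<in> persistent m" "v \<in> persistent m" for u v
    using generically_mono[OF generically_conj[OF irreducible], of "\<lambda>x. u \<in> joined m (fst x)"
        "\<lambda>x. v \<in> joined m (fst x)" "\<lambda>x. u + v \<in> joined m (fst x)"] that subspace_add[OF joined_subspace]
    unfolding persistent_def by auto
  show "sL c u \<in> persistent m" if "u \<in> persistent m" for c u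
    using generically_mono[of X "\<lambda>x. u \<in> joined m (fst x)" "\<lambda>x. sL c u \<in> joined m (fst x)"]
      that subspace_scale[OF joined_subspace] unfolding persistent_def by auto
qed

text \<open>
  Substituting \<open>h(x\<^sub>i)\<close> for \<open>x\<^sub>i\<close> is a surjective self-map of the space of sequences, so it preserves
  genericity. In the application \<open>\<gamma>\<close> is the action of a group element \<open>g\<close> on the space of the
  subspaces and \<open>h\<close> is the action of the inverse of \<open>g\<close> on the cone.
\<close>

lemma persistent_invariant:
  assumes h: "Vector_Spaces.linear s s h" "h \<in> V \<rightarrow> V" "h' \<in> V \<rightarrow> V" "\<And>x. x \<in> V \<Longrightarrow> h (h' x) = x"
    and \<gamma>: "Vector_Spaces.linear sL sL \<gamma>" "\<And>x. x \<in> V \<Longrightarrow> \<gamma> ` F (h x) \<subseteq> F x"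
    and w: "w \<in> persistent m"
  shows "\<gamma> w \<in> persistent m"
proof -
  let ?\<phi> = "\<lambda>x. (\<lambda>i. h (fst x i), snd x)"
  have "generically X (\<lambda>x. w \<in> joined m (fst (?\<phi> x)))"
  proof (rule generically_pullback_surj[of X X ?\<phi>])
    show "continuous_map X X ?\<phi>"
      using h(2) by (intro continuous_map_into_seq_space)
        (auto intro: poly_map_linear[OF _ h(1)] poly_map_seq_nth poly_map_seq_snd)
    show "topspace X \<subseteq> ?\<phi> ` topspace X"
    proof
      fix x assume x: "x \<in> topspace X"
      then have "x = ?\<phi> (\<lambda>i. h' (fst x i), snd x)" using h(4) by (cases x) (auto simp: fun_eq_iff Pi_iff)
      then show "x \<in> ?\<phi> ` topspace X"
        using h(3) x by (intro image_eqI[of _ _ "(\<lambda>i. h' (fst x i), snd x)"]) auto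
    qed
    show "generically X (\<lambda>x. w \<in> joined m (fst x))" using w by (simp add: persistent_def)
  qed
  then have "generically X (\<lambda>x. \<gamma> w \<in> joined m (fst x))"
  proof (rule generically_mono)
    fix x assume x: "x \<in> topspace X" and "w \<in> joined m (fst (?\<phi> x))"
    interpret \<gamma>: Vector_Spaces.linear sL sL \<gamma> by fact
    have "\<gamma> w \<in> \<gamma> ` span (\<Union>i<m. F (h (fst x i)))"
      using \<open>w \<in> joined m (fst (?\<phi> x))\<close> unfolding joined_def by simp
    also have "\<dots> = span (\<gamma> ` (\<Union>i<m. F (h (fst x i))))" by (simp add: \<gamma>.span_image)
    also have "\<dots> \<subseteq> joined m (fst x)"
      unfolding joined_def image_UN
    proof (intro span_mono UN_mono order.refl)
      fix i
      have "fst x i \<in> V" using x by (auto simp: Pi_iff)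
      then show "\<gamma> ` F (h (fst x i)) \<subseteq> F (fst x i)" by (rule \<gamma>(2))
    qed
    finally show "\<gamma> w \<in> joined m (fst x)" .
  qed
  then show ?thesis by (simp add: persistent_def)
qed

lemma persistent_UNIV:
  assumes "persistent m = UNIV"
  shows "generically X (\<lambda>x. joined m (fst x) = UNIV)"
proof -
  have "generically X (\<lambda>x. \<forall>w\<in>BL. w \<in> joined m (fst x))"
    using assms unfolding persistent_def by (intro generically_ball[OF irreducible finite_Basis]) auto
  then show ?thesis
  proof (rule generically_mono)
    fix x assume "\<forall>w\<in>BL. w \<in> joined m (fst x)"
    then have "span BL \<subseteq> joined m (fst x)" by (intro span_minimal joined_subspace) auto
    then show "joined m (fst x) = UNIV" using span_Basis by auto
  qed
qed

text \<open>
  If one more point does not enlarge the intersection with \<open>F' y\<close>, then the intersection can be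
  transported: for a window \<open>x\<^sub>k, ..., x\<^sub>k\<^sub>+\<^sub>m\<close> of \<open>m + 1\<close> points, the first \<open>m\<close> and the last \<open>m\<close> of
  them both cut out the same intersection as all of them. Sliding the window \<open>m\<close> times,
  \<open>x\<^sub>0, ..., x\<^sub>m\<^sub>-\<^sub>1\<close> and \<open>x\<^sub>m, ..., x\<^sub>2\<^sub>m\<^sub>-\<^sub>1\<close> cut out the same subspace, although these two tuples are
  independent of each other. Now fix the first tuple and \<open>y\<close>: a nonzero vector of the intersection
  lies in the span of the members at a generic second tuple.
\<close>

lemma persistent_nonzero:
  assumes d: "generically X (\<lambda>x. dim (joined m (fst x) \<inter> F' (snd x)) = d)"
    and e: "generically X (\<lambda>x. dim (joined (Suc m) (fst x) \<inter> F' (snd x)) = e)"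
    and "e \<le> d" "d \<noteq> 0"
  shows "\<exists>w\<in>persistent m. w \<noteq> 0"
proof -
  define I where "I k x = joined m (\<lambda>i. fst x (i + k)) \<inter> F' (snd x)" for k and x :: "(nat \<Rightarrow> 'v) \<times> 'w"
  define K where "K k x = joined (Suc m) (\<lambda>i. fst x (i + k)) \<inter> F' (snd x)" for k and x :: "(nat \<Rightarrow> 'v) \<times> 'w"
  have "generically X (\<lambda>x. \<forall>k\<in>{..m}. dim (I k x) = d \<and> dim (K k x) = e)"
    using generically_shift[OF generically_conj[OF irreducible d e]] unfolding I_def K_def
    by (intro generically_ball[OF irreducible]) simp_all
  then obtain S x0 where S: "openin X S" "x0 \<in> S" "\<And>x k. x \<in> S \<Longrightarrow> k \<le> m \<Longrightarrow> dim (I k x) = d \<and> dim (K k x) = e"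
    unfolding generically_def by fastforce
  have SX: "S \<subseteq> everywhere" using openin_subset[OF S(1)] by simp
  have slide: "I k x = I 0 x" if "x \<in> S" "k \<le> m" for x k
    using that(2)
  proof (induction k)
    case (Suc k)
    have U: "subspace (F' (snd x))" using subspace' SX that(1) by auto
    have sub: "subspace (I j x)" "subspace (K j x)" for j
      unfolding I_def K_def by (intro subspace_inter joined_subspace U)+
    have "I k x \<subseteq> K k x" unfolding I_def K_def using joined_mono[of m "Suc m"] by auto
    then have "I k x = K k x"
      using S(3)[OF that(1), of k] Suc.prems \<open>e \<le> d\<close> by (intro subspace_dim_equal sub) auto
    moreover have "I (Suc k) x \<subseteq> K k x"
      unfolding I_def K_def using joined_shift_subset[of m "\<lambda>i. fst x (i + k)"] by auto
    then have "I (Suc k) x = K k x"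
      using S(3)[OF that(1), of k] S(3)[OF that(1), of "Suc k"] Suc.prems \<open>e \<le> d\<close>
      by (intro subspace_dim_equal sub) auto
    ultimately show ?case using Suc by simp
  qed simp
  have "dim (I 0 x0) \<noteq> 0" using S(3)[OF S(2), of 0] \<open>d \<noteq> 0\<close> by simp
  then obtain w where w: "w \<in> I 0 x0" "w \<noteq> 0" by auto
  \<comment> \<open>The inclusion of the slice on which \<open>y\<close> and the first \<open>m\<close> points are those of \<open>x0\<close>.\<close>
  let ?\<phi> = "\<lambda>x :: (nat \<Rightarrow> 'v) \<times> 'w. (\<lambda>i. if i < m then fst x0 i else fst x (i - m), snd x0)"
  have \<phi>: "continuous_map X X ?\<phi>"
  proof (rule continuous_map_into_seq_space)
    show "poly_map (seq_coords s s') s (\<lambda>x. fst (?\<phi> x) i)" for i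
      by (cases "i < m") (simp_all add: poly_map_const poly_map_seq_nth)
    show "poly_map (seq_coords s s') s' (\<lambda>x. snd (?\<phi> x))" by (simp add: poly_map_const)
    show "?\<phi> \<in> everywhere \<rightarrow> everywhere"
      using subsetD[OF SX S(2)] by (auto simp: Pi_iff mem_Times_iff)
  qed
  have hit: "?\<phi> (\<lambda>i. fst x0 (i + m), snd x0) = x0"
    by (auto simp: prod_eq_iff fun_eq_iff)
  have "w \<in> I m x" if "x \<in> S" "w \<in> I 0 x" for x using slide[OF that(1), of m] that(2) by simp
  moreover have first_half: "I 0 (?\<phi> x) = I 0 x0" for x
    unfolding I_def using joined_cong[of m "fst (?\<phi> x)" "fst x0"] by simp
  ultimately have "w \<in> I m (?\<phi> x)" if "?\<phi> x \<in> S" for x using w(1) that by blast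
  moreover have "I m (?\<phi> x) \<subseteq> joined m (fst x)" for x unfolding I_def by simp
  ultimately have "w \<in> joined m (fst x)" if "?\<phi> x \<in> S" for x using that by blast
  moreover have "generically X (\<lambda>x. ?\<phi> x \<in> S)"
  proof (rule generically_pullback[OF \<phi> S(1)])
    show "(\<lambda>i. fst x0 (i + m), snd x0) \<in> topspace X"
      using subsetD[OF SX S(2)] by (auto simp: Pi_iff mem_Times_iff)
    show "?\<phi> (\<lambda>i. fst x0 (i + m), snd x0) \<in> S" unfolding hit by (rule S(2))
  qed
  ultimately have "w \<in> persistent m"
    unfolding persistent_def mem_Collect_eq by (elim generically_mono)
  then show ?thesis using w(2) by blast
qed

text \<open>
  Let \<open>d m\<close> be the generic dimension of the intersection, and call \<open>m\<close> full if the span is generically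
  the whole space. An exceptional \<open>m\<close> has \<open>d m \<noteq> 0\<close> and is not full, hence \<open>d m < d (Suc m)\<close> by
  \<open>persistent_nonzero\<close>. Starting from the least exceptional \<open>m0\<close>, where \<open>d m0 \<ge> 1\<close>, the dimension
  thus grows at each step until \<open>m\<close> becomes full, which it then stays. As \<open>d\<close> is bounded by \<open>N'\<close>,
  this takes at most \<open>N'\<close> steps.
\<close>

lemma exceptional_interval:
  assumes simple: "\<And>m. persistent m = {0} \<or> persistent m = UNIV"
  shows "\<exists>a b :: nat. card {a+1..b} \<le> N' \<and> (\<forall>m. m \<notin> {a+1..b} \<longrightarrow>
    generically X (\<lambda>x. joined m (fst x) \<inter> F' (snd x) = {0} \<or> joined m (fst x) = UNIV))"
proof -
  have "\<exists>d. \<forall>m. generically X (\<lambda>x. dim (joined m (fst x) \<inter> F' (snd x)) = d m)"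
  proof (rule choice, rule allI)
    fix m
    obtain d where "generically X (\<lambda>x. dim (joined m (fst x) \<inter> F' (snd x)) = d)"
      by (rule generic_intersection_dim)
    then show "\<exists>d. generically X (\<lambda>x. dim (joined m (fst x) \<inter> F' (snd x)) = d)" by blast
  qed
  then obtain d where d: "\<And>m. generically X (\<lambda>x. dim (joined m (fst x) \<inter> F' (snd x)) = d m)" by blast
  define full where "full m \<longleftrightarrow> generically X (\<lambda>x. joined m (fst x) = UNIV)" for m
  have full_mono: "full n" if "full m" "m \<le> n" for m n
    using that(1) unfolding full_def
    by (rule generically_mono) (use joined_mono[OF that(2)] in blast)
  have grow: "d m < d (Suc m)" if "d m \<noteq> 0" "\<not> full m" for m
  proof (rule ccontr)
    assume "\<not> d m < d (Suc m)"
    then have "persistent m \<noteq> {0}" using persistent_nonzero[OF d d _ that(1)] by force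
    then show False using simple persistent_UNIV that(2) unfolding full_def by blast
  qed
  have d_le: "d m \<le> N'" for m
  proof -
    obtain x where "dim (joined m (fst x) \<inter> F' (snd x)) = d m" "dim (F' (snd x)) = N'"
      using generically_exists[OF generically_conj[OF irreducible d generic_dim']] by blast
    then show ?thesis using dim_subset[of "joined m (fst x) \<inter> F' (snd x)" "F' (snd x)"] by simp
  qed
  have d_0: "d 0 = 0"
  proof -
    obtain x where "dim (joined 0 (fst x) \<inter> F' (snd x)) = d 0" using generically_exists[OF d] by blast
    moreover have "joined 0 (fst x) \<inter> F' (snd x) \<subseteq> {0}" by (auto simp: joined_def)
    ultimately show ?thesis using dim_eq_0 by metis
  qed
  have good: "generically X (\<lambda>x. joined m (fst x) \<inter> F' (snd x) = {0} \<or> joined m (fst x) = UNIV)"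
    if "d m = 0 \<or> full m" for m
    using that
  proof
    assume "full m"
    then show ?thesis unfolding full_def by (rule generically_mono) blast
  next
    assume d0: "d m = 0"
    show ?thesis
    proof (rule generically_mono[OF d[of m]])
      fix x assume x: "x \<in> topspace X" "dim (joined m (fst x) \<inter> F' (snd x)) = d m"
      have "subspace (joined m (fst x) \<inter> F' (snd x))"
        using subspace' x(1) by (intro subspace_inter joined_subspace) auto
      then show "joined m (fst x) \<inter> F' (snd x) = {0} \<or> joined m (fst x) = UNIV"
        using x(2) d0 subspace_0 by auto
    qed
  qed
  show ?thesis
  proof (cases "\<exists>m. d m \<noteq> 0 \<and> \<not> full m")
    case False
    then show ?thesis using good by (intro exI[of _ 0]) auto
  next
    case True
    define m0 where "m0 = (LEAST m. d m \<noteq> 0 \<and> \<not> full m)"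
    have m0: "d m0 \<noteq> 0 \<and> \<not> full m0" unfolding m0_def using True by (rule LeastI_ex)
    have below: "d m = 0 \<or> full m" if "m < m0" for m using not_less_Least that unfolding m0_def by blast
    have climb: "full (m0 + k) \<or> k < d (m0 + k)" for k
    proof (induction k)
      case 0
      show ?case using m0 by simp
    next
      case (Suc k)
      then show ?case using full_mono[of "m0 + k" "m0 + Suc k"] grow[of "m0 + k"] by fastforce
    qed
    have above: "full m" if "m0 + N' \<le> m" for m
      using climb[of N'] d_le[of "m0 + N'"] full_mono[OF _ that] by linarith
    \<comment> \<open>Needed because an interval \<open>{a+1..b}\<close> cannot start at \<open>0\<close>.\<close>
    have "m0 \<noteq> 0" using m0 d_0 by metis
    then have "m < m0 \<or> m0 + N' \<le> m" if "m \<notin> {(m0 - 1) + 1..m0 - 1 + N'}" for m using that by auto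
    then have "d m = 0 \<or> full m" if "m \<notin> {(m0 - 1) + 1..m0 - 1 + N'}" for m using that below above by blast
    then show ?thesis using good by (intro exI[of _ "m0 - 1"] exI[of _ "m0 - 1 + N'"]) auto
  qed
qed

end

section \<open>Equivariance and the theorem\<close>

text \<open>
  A positive dimension guarantees that the projectivization is not empty: a chain of two irreducible
  closed subsets already forces two points.
\<close>

lemma krull_dim_pos_nonzero_point:
  assumes "krull_dim (subtopology (zariski C) V) = enat N" "N \<ge> 1"
  obtains x where "x \<in> V" "x \<noteq> (0 :: 'a::zero)"
proof -
  have "\<exists>x\<in>V. x \<noteq> 0"
  proof (rule ccontr)
    assume "\<not> ?thesis"
    then have V: "V \<subseteq> {0}" by blast
    have "n = 0"
      if Z: "\<forall>i\<le>n. closedin (subtopology (zariski C) V) (Z i) \<and>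
          irreducible_space (subtopology (subtopology (zariski C) V) (Z i))"
        "\<forall>i<n. Z i \<subset> Z (Suc i)" for n and Z :: "nat \<Rightarrow> 'a set"
    proof (rule ccontr)
      assume "n \<noteq> 0"
      then have "Z 0 \<noteq> {}" "Z 1 \<subseteq> V" "Z 0 \<subset> Z 1"
        using Z closedin_subset[of "subtopology (zariski C) V" "Z 1"]
        by (auto simp: irreducible_space_def Suc_le_eq)
      then show False using V by blast
    qed
    then have "krull_dim (subtopology (zariski C) V) \<le> enat 0"
      unfolding krull_dim_def by (intro Sup_least) auto
    then show False using assms by simp
  qed
  then show thesis using that by blast
qed

lemma fibre_equivariant:
  assumes \<rho>: "Vector_Spaces.linear s s (\<rho> g)" "bij (\<rho> g)" and \<rho>L: "Vector_Spaces.linear sL sL (\<rho>L g)"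
    and eq: "G_equivariant G \<rho> \<rho>L (projectivization s V) T" and g: "g \<in> carrier G" and x: "x \<in> V"
  shows "fibre s T (\<rho> g x) = \<rho>L g ` fibre s T x"
proof -
  interpret \<rho>: Vector_Spaces.linear s s "\<rho> g" by fact
  interpret \<rho>L: Vector_Spaces.linear sL sL "\<rho>L g" by fact
  show ?thesis
  proof (cases "x = 0")
    case True
    then show ?thesis by (simp add: fibre_def)
  next
    case False
    then have "\<rho> g x \<noteq> 0" using bij_is_inj[OF \<rho>(2)] by (metis \<rho>.zero injD)
    moreover have "module.span s {\<rho> g x} = \<rho> g ` module.span s {x}"
      using \<rho>.span_image[of "{x}"] by simp
    moreover have "module.span s {x} \<in> projectivization s V"
      using x False unfolding projectivization_def by blast
    ultimately show ?thesis using eq g False by (simp add: fibre_def G_equivariant_def)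
  qed
qed

text \<open>
  Freeze the coordinates from \<open>m\<close> on at those of a point in the open set that witnesses genericity.
\<close>

lemma generically_seq_to_tuple:
  assumes gen: "generically (seq_space s V s' V') P"
    and dep: "\<And>z z' y. (\<And>i. i < m \<Longrightarrow> z i = z' i) \<Longrightarrow> P (z, y) \<Longrightarrow> P (z', y)"
  shows "generically (subtopology (zariski (tuple_coords m s s')) (({..<m} \<rightarrow>\<^sub>E V) \<times> V')) P"
proof -
  obtain S z0 y0 where S: "openin (seq_space s V s' V') S" "(z0, y0) \<in> S" "\<forall>x\<in>S. P x"
    using gen unfolding generically_def by fast
  have z0: "z0 \<in> UNIV \<rightarrow> V" "y0 \<in> V'" using openin_subset[OF S(1)] S(2) by auto
  let ?\<phi> = "\<lambda>x :: (nat \<Rightarrow> 'a) \<times> 'b. (\<lambda>i. if i < m then fst x i else z0 i, snd x)"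
  have "generically (subtopology (zariski (tuple_coords m s s')) (({..<m} \<rightarrow>\<^sub>E V) \<times> V')) (\<lambda>x. P (?\<phi> x))"
  proof (rule generically_pullback[OF _ S(1)])
    show "continuous_map (subtopology (zariski (tuple_coords m s s')) (({..<m} \<rightarrow>\<^sub>E V) \<times> V'))
        (seq_space s V s' V') ?\<phi>"
    proof (rule continuous_map_into_seq_space)
      show "poly_map (tuple_coords m s s') s (\<lambda>x. fst (?\<phi> x) i)" for i
        by (cases "i < m") (simp_all add: poly_map_const poly_map_tuple_nth)
      show "poly_map (tuple_coords m s s') s' (\<lambda>x. snd (?\<phi> x))" by (simp add: poly_map_tuple_snd)
      show "?\<phi> \<in> ({..<m} \<rightarrow>\<^sub>E V) \<times> V' \<rightarrow> (UNIV \<rightarrow> V) \<times> V'" using z0 by (auto simp: Pi_iff PiE_iff)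
    qed
    show "(restrict z0 {..<m}, y0) \<in> topspace (subtopology (zariski (tuple_coords m s s')) (({..<m} \<rightarrow>\<^sub>E V) \<times> V'))"
      using z0 by auto
    have "?\<phi> (restrict z0 {..<m}, y0) = (z0, y0)" by (auto simp: fun_eq_iff)
    then show "?\<phi> (restrict z0 {..<m}, y0) \<in> S" using S(2) by simp
  qed (use S(3) in blast)
  then show ?thesis
  proof (rule generically_mono)
    fix x assume "P (?\<phi> x)"
    then show "P x" using dep[of "fst (?\<phi> x)" "fst x" "snd x"] by simp
  qed
qed

theorem theorem3p4:
  fixes G :: "('g, 'b) monoid_scheme"
    and sL :: "complex \<Rightarrow> 'l::ab_group_add \<Rightarrow> 'l" and \<rho>L :: "'g \<Rightarrow> 'l \<Rightarrow> 'l"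
    and s :: "complex \<Rightarrow> 'v::ab_group_add \<Rightarrow> 'v" and \<rho> :: "'g \<Rightarrow> 'v \<Rightarrow> 'v"
    and s' :: "complex \<Rightarrow> 'w::ab_group_add \<Rightarrow> 'w" and \<rho>' :: "'g \<Rightarrow> 'w \<Rightarrow> 'w"
    and V :: "'v set" and V' :: "'w set" and N N' :: nat
    and T :: "'v set \<Rightarrow> 'l set" and U :: "'w set \<Rightarrow> 'l set"
  assumes "group G"
    and "irreducible_G_module G sL \<rho>L"
    and "G_module G s \<rho>" and "affine_cone s V" and "G_invariant G \<rho> V"
    and "irreducible_space (zariski_on s V)"
    and "krull_dim (zariski_on s V) = enat N" and "N \<ge> 1"
    and "G_module G s' \<rho>'" and "affine_cone s' V'" and "G_invariant G \<rho>' V'"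
    and "irreducible_space (zariski_on s' V')"
    and "krull_dim (zariski_on s' V') = enat N'" and "N' \<ge> 1"
    and "algebraic_map_to_Gr s V sL N T"
    and "G_equivariant G \<rho> \<rho>L (projectivization s V) T"
    and "algebraic_map_to_Gr s' V' sL N' U"
    and "G_equivariant G \<rho>' \<rho>L (projectivization s' V') U"
  shows "\<exists>a b :: nat. card {a+1..b} \<le> N' \<and>
    (\<forall>m. m \<notin> {a+1..b} \<longrightarrow>
      generically
        (subtopology (zariski (tuple_coords m s s')) (({..<m} \<rightarrow>\<^sub>E V) \<times> V'))
        (\<lambda>(x, y). (\<forall>i<m. x i \<noteq> 0) \<and> y \<noteq> 0 \<and>
          (let A = module.span sL (\<Union>i<m. T (module.span s {x i})) in
            A \<inter> U (module.span s' {y}) = {0} \<or> A = UNIV)))"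
proof -
  obtain BL where BL: "finite_dimensional_vector_space sL BL"
    using assms(2) unfolding irreducible_G_module_def G_module_def by blast
  interpret L: finite_dimensional_vector_space sL BL by fact
  have s: "vector_space s" and s': "vector_space s'"
    using assms(3,9) unfolding G_module_def finite_dimensional_vector_space_def by blast+
  let ?F = "fibre s T" and ?F' = "fibre s' U" and ?X = "seq_space s V s' V'"
  have irr: "irreducible_space ?X" by (rule irreducible_seq_space[OF assms(6,12)])
  \<comment> \<open>Generic points are nonzero, so over them the families \<open>?F\<close> and \<open>?F'\<close> are the given ones.\<close>
  obtain v v' where v: "v \<in> V" "v \<noteq> 0" and v': "v' \<in> V'" "v' \<noteq> 0"
    using krull_dim_pos_nonzero_point[OF assms(7,8)] krull_dim_pos_nonzero_point[OF assms(13,14)] by metis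
  have nz: "generically ?X (\<lambda>x. fst x i \<noteq> 0)" for i
  proof -
    obtain f where f: "f \<in> linear_functionals s" "f v \<noteq> 0" by (rule linear_functional_separates[OF s v(2)])
    have "openin ?X {x \<in> (UNIV \<rightarrow> V) \<times> V'. f (fst x i) \<noteq> 0}"
      by (rule openin_zariski_nonvanishing) (rule poly_mapD[OF poly_map_seq_nth f(1)])
    moreover have "(\<lambda>_. v, v') \<in> {x \<in> (UNIV \<rightarrow> V) \<times> V'. f (fst x i) \<noteq> 0}" using v v' f by simp
    ultimately show ?thesis
      unfolding generically_def using linear_functional_zero[OF f(1)]
      by (intro exI[of _ "{x \<in> (UNIV \<rightarrow> V) \<times> V'. f (fst x i) \<noteq> 0}"]) auto
  qed
  have nz': "generically ?X (\<lambda>x. snd x \<noteq> 0)"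
  proof -
    obtain f where f: "f \<in> linear_functionals s'" "f v' \<noteq> 0" by (rule linear_functional_separates[OF s' v'(2)])
    have "openin ?X {x \<in> (UNIV \<rightarrow> V) \<times> V'. f (snd x) \<noteq> 0}"
      by (rule openin_zariski_nonvanishing) (rule poly_mapD[OF poly_map_seq_snd f(1)])
    moreover have "(\<lambda>_. v, v') \<in> {x \<in> (UNIV \<rightarrow> V) \<times> V'. f (snd x) \<noteq> 0}" using v v' f by simp
    ultimately show ?thesis
      unfolding generically_def using linear_functional_zero[OF f(1)]
      by (intro exI[of _ "{x \<in> (UNIV \<rightarrow> V) \<times> V'. f (snd x) \<noteq> 0}"]) auto
  qed
  interpret generated_families sL BL s V s' V' ?F ?F' N'
  proof
    show "irreducible_space ?X" by (rule irr)
    show "globally_generated (linear_functionals s) V sL ?F"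
      by (rule algebraic_map_globally_generated[OF s BL assms(15)])
    show "globally_generated (linear_functionals s') V' sL ?F'"
      by (rule algebraic_map_globally_generated[OF s' BL assms(17)])
    show "L.subspace (?F' y)" if "y \<in> V'" for y
      by (rule fibre_subspace[OF L.vector_space_axioms assms(17) that])
    show "generically ?X (\<lambda>x. L.dim (?F' (snd x)) = N')"
      using nz'
    proof (rule generically_mono)
      fix x assume "x \<in> topspace ?X" "snd x \<noteq> 0"
      then show "L.dim (?F' (snd x)) = N'"
        using algebraic_map_fibre_in_Gr[OF assms(17), of "snd x"] by (auto simp: fibre_def Gr_def)
    qed
  qed
  have "persistent m = {0} \<or> persistent m = UNIV" for m
  proof -
    have "G_invariant G \<rho>L (persistent m)"
      unfolding G_invariant_def
    proof (intro ballI)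
      fix g w assume g: "g \<in> carrier G" and w: "w \<in> persistent m"
      interpret group G by fact
      interpret \<rho>: group_action G UNIV \<rho> using assms(3) by (simp add: G_module_def)
      have g': "inv\<^bsub>G\<^esub> g \<in> carrier G" using g by simp
      have lin: "Vector_Spaces.linear s s (\<rho> h)" "Vector_Spaces.linear sL sL (\<rho>L h)" if "h \<in> carrier G" for h
        using assms(2,3) that unfolding irreducible_G_module_def G_module_def by blast+
      have cancel: "\<rho> (inv\<^bsub>G\<^esub> g) (\<rho> g x) = x" "\<rho> g (\<rho> (inv\<^bsub>G\<^esub> g) x) = x" for x
        using \<rho>.orbit_sym_aux[OF g, of x] \<rho>.orbit_sym_aux[OF g', of x] g by auto
      have bij: "bij (\<rho> g)" by (rule o_bij[of "\<rho> (inv\<^bsub>G\<^esub> g)"]) (auto simp: cancel)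
      have stable: "\<rho> h x \<in> V" if "h \<in> carrier G" "x \<in> V" for h x
        using assms(5) that unfolding G_invariant_def by blast
      show "\<rho>L g w \<in> persistent m"
      proof (rule persistent_invariant[OF lin(1)[OF g'] _ _ cancel(1) lin(2)[OF g] _ w])
        show "\<rho> (inv\<^bsub>G\<^esub> g) \<in> V \<rightarrow> V" "\<rho> g \<in> V \<rightarrow> V" using stable g g' by auto
        fix x assume x: "x \<in> V"
        show "\<rho>L g ` ?F (\<rho> (inv\<^bsub>G\<^esub> g) x) \<subseteq> ?F x"
          using fibre_equivariant[OF lin(1)[OF g] bij lin(2)[OF g] assms(16) g stable[OF g' x]] cancel(2) by simp
      qed
    qed
    then show ?thesis using assms(2) persistent_subspace unfolding irreducible_G_module_def by blast
  qed
  from exceptional_interval[OF this] obtain a b where ab: "card {a+1..b} \<le> N'"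
    "\<And>m. m \<notin> {a+1..b} \<Longrightarrow> generically ?X (\<lambda>x. joined m (fst x) \<inter> ?F' (snd x) = {0} \<or> joined m (fst x) = UNIV)"
    by blast
  show ?thesis
  proof (intro exI conjI allI impI)
    show "card {a+1..b} \<le> N'" by (rule ab)
    fix m assume m: "m \<notin> {a+1..b}"
    have *: "(\<lambda>(x, y). (\<forall>i<m. x i \<noteq> 0) \<and> y \<noteq> 0 \<and>
          (let A = module.span sL (\<Union>i<m. T (module.span s {x i})) in
            A \<inter> U (module.span s' {y}) = {0} \<or> A = UNIV)) =
        (\<lambda>x. (\<forall>i\<in>{..<m}. fst x i \<noteq> 0) \<and> snd x \<noteq> 0 \<and>
          (joined m (fst x) \<inter> ?F' (snd x) = {0} \<or> joined m (fst x) = UNIV))"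
    proof -
      have "joined m x = L.span (\<Union>i<m. T (module.span s {x i}))" if "\<forall>i<m. x i \<noteq> 0" for x
        using that by (simp add: joined_def fibre_def)
      moreover have "?F' y = U (module.span s' {y})" if "y \<noteq> 0" for y
        using that by (simp add: fibre_def)
      ultimately show ?thesis by (auto simp: fun_eq_iff Let_def)
    qed
    show "generically (subtopology (zariski (tuple_coords m s s')) (({..<m} \<rightarrow>\<^sub>E V) \<times> V'))
        (\<lambda>(x, y). (\<forall>i<m. x i \<noteq> 0) \<and> y \<noteq> 0 \<and>
          (let A = module.span sL (\<Union>i<m. T (module.span s {x i})) in
            A \<inter> U (module.span s' {y}) = {0} \<or> A = UNIV))"
      unfolding *
    proof (rule generically_seq_to_tuple)
      show "generically ?X (\<lambda>x. (\<forall>i\<in>{..<m}. fst x i \<noteq> 0) \<and> snd x \<noteq> 0 \<and>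
          (joined m (fst x) \<inter> ?F' (snd x) = {0} \<or> joined m (fst x) = UNIV))"
        by (intro generically_conj[OF irr] generically_ball[OF irr] nz nz' ab(2)[OF m]) simp
      fix z z' :: "nat \<Rightarrow> 'v" and y
      assume "\<And>i. i < m \<Longrightarrow> z i = z' i"
      moreover from this have "joined m z = joined m z'" by (rule joined_cong)
      moreover assume "(\<forall>i\<in>{..<m}. fst (z, y) i \<noteq> 0) \<and> snd (z, y) \<noteq> 0 \<and>
          (joined m (fst (z, y)) \<inter> ?F' (snd (z, y)) = {0} \<or> joined m (fst (z, y)) = UNIV)"
      ultimately show "(\<forall>i\<in>{..<m}. fst (z', y) i \<noteq> 0) \<and> snd (z', y) \<noteq> 0 \<and>
          (joined m (fst (z', y)) \<inter> ?F' (snd (z', y)) = {0} \<or> joined m (fst (z', y)) = UNIV)"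
        by simp
    qed
  qed
qed

end
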